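(* Let ${\bf d}={\bf d}(n)=(d_1,\ldots,d_n)$ be a degree sequence (for each $n$) satisfying $J({\bf d})=o(\|{\bf d}\|_1)$ and $\delta({\bf d})\gg\log n$ as $n\to\infty$. Then there is a symmetric matrix $W\in[0,1]^{[n]\times[n]}$ with $W=(1+o(1))f_c(P({\bf d}))$ (entrywise, with the $o(1)$ uniform over all entries), where $f(x)=1-e^{-x}$, and a coupling $(G_L,G)$ with $G_L\sim\mathcal G(n,W)$ and $G\sim\mathcal G(n,{\bf d})$ such that $\mathbb P(G_L\subseteq G)=1-o(1)$.
   Context: A degree sequence ${\bf d}=(d_1,\dots,d_n)$ is a sequence of nonnegative integers that is the degree sequence of some simple graph on $[n]$; $\|{\bf d}\|_1=\sum_i d_i$, $\delta({\bf d})=\min_i d_i$, $\Delta({\bf d})=\max_i d_i$. $J({\bf d})$ is the sum of the $\Delta({\bf d})$ largest entries of ${\bf d}$ (i.e. if $d_1\ge\cdots\ge d_n$ then $J({\bf d})=\sum_{i=1}^{d_1}d_i$). $\mathcal G(n,{\bf d})$ denotes a uniformly random simple graph on $[n]$ with degree sequence ${\bf d}$. For a symmetric matrix $W\in[0,1]^{[n]\times[n]}$, $\mathcal G(n,W)$ is the random graph on $[n]$ in which each edge $jk$ ($j\neq k$) is included independently with probability $W_{jk}$. $P({\bf d})$ is the symmetric $n\times n$ matrix with $P_{ij}=\frac{d_id_j}{\|{\bf d}\|_1+d_id_j}$ for $i\ne j$ and $P_{ii}=0$. For a function $f:\mathbb R\to\mathbb R$ and a matrix $P$, $f_c(P)$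 is the matrix $(f(P_{ij}))_{i,j\in[n]}$. A coupling is a pair of random graphs on a common probability space with the given marginals. Asymptotics are as $n\to\infty$. *)

theory Defs
  imports "HOL-Probability.Probability" "HOL-Library.Landau_Symbols"
begin

text \<open>A simple graph on the vertex set \<open>{1..n}\<close> is identified with its set of edges,
  so that \<open>\<subseteq>\<close> is the spanning subgraph relation.\<close>

type_synonym graph = "nat set set"

definition simple_graph :: "nat \<Rightarrow> graph \<Rightarrow> bool" where
  "simple_graph n G \<longleftrightarrow> (\<forall>e\<in>G. e \<subseteq> {1..n} \<and> card e = 2)"

definition degree :: "graph \<Rightarrow> nat \<Rightarrow> nat" where
  "degree G v = card {e \<in> G. v \<in> e}"

text \<open>Sequences \<open>(d\<^sub>1, \<dots>, d\<^sub>n)\<close> are functions on \<open>nat\<close> of which only the values on \<open>{1..n}\<close>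
  matter; likewise for \<open>n \<times> n\<close> matrices.\<close>

definition graphs_with_degrees :: "nat \<Rightarrow> (nat \<Rightarrow> nat) \<Rightarrow> graph set" where
  "graphs_with_degrees n d = {G. simple_graph n G \<and> (\<forall>v\<in>{1..n}. degree G v = d v)}"

definition degree_sequence :: "nat \<Rightarrow> (nat \<Rightarrow> nat) \<Rightarrow> bool" where
  "degree_sequence n d \<longleftrightarrow> (\<exists>G. G \<in> graphs_with_degrees n d)"

definition norm1 :: "nat \<Rightarrow> (nat \<Rightarrow> nat) \<Rightarrow> nat" where
  "norm1 n d = (\<Sum>i\<in>{1..n}. d i)"

text \<open>For \<open>n = 0\<close> the next two values are unspecified.\<close>

definition min_deg :: "nat \<Rightarrow> (nat \<Rightarrow> nat) \<Rightarrow> nat" where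
  "min_deg n d = Min (d ` {1..n})"

definition max_deg :: "nat \<Rightarrow> (nat \<Rightarrow> nat) \<Rightarrow> nat" where
  "max_deg n d = Max (d ` {1..n})"

definition J :: "nat \<Rightarrow> (nat \<Rightarrow> nat) \<Rightarrow> nat" where
  "J n d = sum_list (take (max_deg n d) (rev (sort (map d [1..<Suc n]))))"

definition uniform_graph :: "nat \<Rightarrow> (nat \<Rightarrow> nat) \<Rightarrow> graph pmf" where
  "uniform_graph n d = pmf_of_set (graphs_with_degrees n d)"

text \<open>One independent Bernoulli variable for each pair \<open>j < k\<close>.  Only the entries of \<open>W\<close> above the
  diagonal are used, which determine a symmetric matrix off its diagonal.\<close>

definition vertex_pairs :: "nat \<Rightarrow> (nat \<times> nat) set" where
  "vertex_pairs n = {(j, k). j \<in> {1..n} \<and> k \<in> {1..n} \<and> j < k}"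

definition indep_graph :: "nat \<Rightarrow> (nat \<Rightarrow> nat \<Rightarrow> real) \<Rightarrow> graph pmf" where
  "indep_graph n W =
     map_pmf (\<lambda>x. {{j, k} | j k. (j, k) \<in> vertex_pairs n \<and> x (j, k)})
       (Pi_pmf (vertex_pairs n) False (\<lambda>(j, k). bernoulli_pmf (W j k)))"

definition prob_matrix :: "nat \<Rightarrow> (nat \<Rightarrow> nat) \<Rightarrow> nat \<Rightarrow> nat \<Rightarrow> real" where
  "prob_matrix n d i j =
     (if i = j then 0 else real (d i * d j) / real (norm1 n d + d i * d j))"

definition entrywise :: "(real \<Rightarrow> real) \<Rightarrow> (nat \<Rightarrow> nat \<Rightarrow> real) \<Rightarrow> nat \<Rightarrow> nat \<Rightarrow> real" where
  "entrywise f A i j = f (A i j)"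

definition symmetric_01 :: "nat \<Rightarrow> (nat \<Rightarrow> nat \<Rightarrow> real) \<Rightarrow> bool" where
  "symmetric_01 n W \<longleftrightarrow> (\<forall>i\<in>{1..n}. \<forall>j\<in>{1..n}. W i j = W j i \<and> W i j \<in> {0..1})"

text \<open>A sequence of \<open>n \<times> n\<close> matrices that is \<open>o(1)\<close> uniformly over all entries.\<close>

definition uniformly_o1 :: "(nat \<Rightarrow> nat \<Rightarrow> nat \<Rightarrow> real) \<Rightarrow> bool" where
  "uniformly_o1 E \<longleftrightarrow>
     (\<forall>\<eta>>0. \<forall>\<^sub>F n in sequentially. \<forall>i\<in>{1..n}. \<forall>j\<in>{1..n}. \<bar>E n i j\<bar> < \<eta>)"

text \<open>A coupling is given by the joint law of the pair.\<close>

definition coupling :: "('a \<times> 'b) pmf \<Rightarrow> 'a pmf \<Rightarrow> 'b pmf \<Rightarrow> bool" where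
  "coupling \<mu> p q \<longleftrightarrow> map_pmf fst \<mu> = p \<and> map_pmf snd \<mu> = q"

end

theory Submission imports Defs "HOL-Real_Asymp.Real_Asymp" begin

text \<open>Reveal the edges of the uniform graph \<open>G\<close> with degrees \<open>d\<close> in uniformly random order, and let
  \<open>H\<close> be the set of the first \<open>k\<close> of its \<open>m\<close> edges. Given \<open>H\<close>, the graph \<open>G\<close> is uniform among the
  realisations of \<open>d\<close> that contain \<open>H\<close>, and a three-edge switching bounds the probability that it
  contains \<open>e = j k\<close> below by about \<open>(1 - k / m) P\<^sub>j\<^sub>k\<close>, as long as every vertex still has about the
  proportion \<open>1 - k / m\<close> of its edges unrevealed. By Hoeffding's inequality and \<open>\<delta>(d) \<gg> log n\<close> this
  holds for all \<open>k \<le> (1 - \<epsilon>) m\<close> with high probability. The next edge is therefore \<open>e\<close> with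
  probability at least about \<open>P\<^sub>j\<^sub>k / m\<close>, a bound that does not depend on the history. So the revealed
  edges can be coupled to contain independent draws, each of which is \<open>e\<close> with probability
  \<open>(1 - \<epsilon>)\<^sup>3 P\<^sub>j\<^sub>k / m\<close>. A Poisson number of such draws, with mean \<open>(1 - \<epsilon>)\<^sup>2 m\<close>, hits the edges
  independently, and hits \<open>e\<close> with probability \<open>1 - exp (- (1 - \<epsilon>)\<^sup>5 P\<^sub>j\<^sub>k)\<close>. Finally let
  \<open>\<epsilon> \<rightarrow> 0\<close> slowly.\<close>

section \<open>Probability mass functions\<close>

text \<open>The draws are made with replacement. A draw that repeats a revealed edge is harmless for
  the coupling but adds nothing, and this waste is what turns \<open>P\<close> into
  \<open>1 - exp (- P)\<close>. The bound on the rate is free of the history because the switching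
  yields a factor s = 1 - k / m, which cancels against the number m - k = s m of edges still to be
  revealed. Stopping at (1 - \<epsilon>) m keeps s \<ge> \<epsilon>, so that an additive error
  \<epsilon>^2 in the revealed proportions, or in 4 J relative to the degree sum, is at most a
  relative error \<epsilon>. Of the five factors 1 - \<epsilon>, three pay for the two residual
  degrees and for the choice of the third edge, one for stopping early, and one leaves room for the
  fluctuation of the Poisson variable. The minimum degree has to beat every multiple of log n
  because, for each fixed \<epsilon>, an exponentially small tail must absorb a union bound over n
  vertices and up to m times together with a factor m + 1.\<close>

lemma pmf_eqI_Pow:
  fixes p q :: "'a set pmf"
  assumes "finite E" "set_pmf p \<subseteq> Pow E" "set_pmf q \<subseteq> Pow E"
    and eq: "\<And>S. S \<subseteq> E \<Longrightarrow> measure_pmf.prob p (Pow S) = measure_pmf.prob q (Pow S)"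
  shows "p = q"
proof (rule pmf_eqI)
  fix S
  show "pmf p S = pmf q S"
  proof (cases "S \<subseteq> E")
    case False
    then show ?thesis using assms(2,3) by (metis PowD pmf_eq_0_set_pmf subsetD)
  next
    case True
    then have "finite S" using \<open>finite E\<close> finite_subset by blast
    then show ?thesis using True
    proof (induction S rule: finite_psubset_induct)
      case (psubset S)
      have fin: "finite (Pow S)" using psubset.hyps by simp
      \<comment> \<open>Inversion over the subset lattice: the mass at \<open>S\<close> is what
        remains of \<open>Pow S\<close> once the proper subsets, known by induction, are taken
        off.\<close>
      have split: "measure_pmf.prob r (Pow S) = pmf r S + sum (pmf r) (Pow S - {S})" for r :: "'a set pmf"
        using fin by (simp add: measure_measure_pmf_finite sum.remove[of "Pow S" S])
      have "sum (pmf p) (Pow S - {S}) = sum (pmf q) (Pow S - {S})"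
      proof (rule sum.cong)
        fix T assume "T \<in> Pow S - {S}"
        then have "T \<subset> S" "T \<subseteq> E" using psubset.prems by auto
        then show "pmf p T = pmf q T" by (rule psubset.IH)
      qed simp
      then show ?case using split[of p] split[of q] eq[OF psubset.prems] by linarith
    qed
  qed
qed

text \<open>Both total masses are one, so a deficit at \<open>x\<close> would have to be made up on
  the complement of \<open>x\<close>, where domination forbids it.\<close>

lemma pmf_eqI_le:
  assumes "\<And>x. pmf p x \<le> pmf q x"
  shows "p = q"
proof (rule pmf_eqI)
  fix x
  have "measure_pmf.prob p (- {x}) \<le> measure_pmf.prob q (- {x})"
  proof -
    have "emeasure (measure_pmf p) (- {x}) \<le> emeasure (measure_pmf q) (- {x})"
      unfolding nn_integral_pmf[symmetric] by (intro nn_integral_mono ennreal_leI assms)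
    then show ?thesis by (simp add: measure_pmf.emeasure_eq_measure)
  qed
  moreover have "measure_pmf.prob r (- {x}) = 1 - pmf r x" for r :: "'a pmf"
    using measure_pmf.prob_compl[of "{x}" r] by (simp add: Compl_eq_Diff_UNIV measure_pmf_single)
  ultimately show "pmf p x = pmf q x" using assms[of x] by simp
qed

text \<open>Keep \<open>x\<close> if it lies outside \<open>B\<close>; otherwise resample from the
  normalised mass that \<open>r\<close> has left over. In the application \<open>B\<close> consists
  of the draws that add nothing new, which may be paired with anything, so domination is only
  required for unrevealed edges.\<close>

lemma ex_coupling_off:
  fixes p r :: "'a pmf"
  assumes le: "\<And>x. x \<notin> B \<Longrightarrow> pmf p x \<le> pmf r x"
  shows "\<exists>\<kappa>. coupling \<kappa> p r \<and> (\<forall>(x, y)\<in>set_pmf \<kappa>. x \<in> B \<or> x = y)"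
proof (cases "measure_pmf.prob p B = 0")
  case True
  have "pmf p x \<le> pmf r x" for x
  proof (cases "x \<in> B")
    case True
    then have "pmf p x \<le> measure_pmf.prob p B"
      unfolding measure_pmf_single[symmetric] by (intro measure_pmf.finite_measure_mono) auto
    with \<open>measure_pmf.prob p B = 0\<close> show ?thesis by (simp add: order_trans[OF _ pmf_nonneg])
  qed (rule le)
  then have "p = r" by (rule pmf_eqI_le)
  then show ?thesis
    by (intro exI[of _ "map_pmf (\<lambda>x. (x, x)) p"]) (auto simp: coupling_def pmf.map_comp o_def)
next
  case False
  define b where "b = measure_pmf.prob p B"
  have b: "b > 0" using False by (simp add: b_def zero_less_measure_iff)
  \<comment> \<open>The excess of \<open>r\<close> over the mass that is matched outside
    \<open>B\<close>. It totals exactly \<open>b\<close>, the mass of \<open>p\<close> still to be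
    placed; the case \<open>b = 0\<close>, where it cannot be normalised, has been split
    off.\<close>
  define g where "g e = (pmf r e - indicator (- B) e * pmf p e) / b" for e
  have g0: "g e \<ge> 0" for e using le[of e] b by (auto simp: g_def indicator_def)
  have "(\<integral>\<^sup>+e. ennreal (g e) \<partial>count_space UNIV) =
      (\<integral>\<^sup>+e. ennreal (inverse b) * (ennreal (pmf r e) - ennreal (indicator (- B) e * pmf p e)) \<partial>count_space UNIV)"
  proof (intro nn_integral_cong)
    fix e
    have "ennreal (pmf r e) - ennreal (indicator (- B) e * pmf p e)
        = ennreal (pmf r e - indicator (- B) e * pmf p e)"
      by (rule ennreal_minus) simp
    moreover have "g e = inverse b * (pmf r e - indicator (- B) e * pmf p e)"
      by (simp add: g_def divide_inverse mult.commute)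
    ultimately show "ennreal (g e) =
        ennreal (inverse b) * (ennreal (pmf r e) - ennreal (indicator (- B) e * pmf p e))"
      using b by (simp only: ennreal_mult' inverse_nonnegative_iff_nonnegative less_imp_le)
  qed
  also have "\<dots> = ennreal (inverse b) *
      (\<integral>\<^sup>+e. (ennreal (pmf r e) - ennreal (indicator (- B) e * pmf p e)) \<partial>count_space UNIV)"
    by (rule nn_integral_cmult) simp
  also have "(\<integral>\<^sup>+e. (ennreal (pmf r e) - ennreal (indicator (- B) e * pmf p e)) \<partial>count_space UNIV) =
      (\<integral>\<^sup>+e. ennreal (pmf r e) \<partial>count_space UNIV) - (\<integral>\<^sup>+e. ennreal (indicator (- B) e * pmf p e) \<partial>count_space UNIV)"
  proof (rule nn_integral_diff)
    have "(\<integral>\<^sup>+e. ennreal (indicator (- B) e * pmf p e) \<partial>count_space UNIV) \<le> (\<integral>\<^sup>+e. ennreal (pmf p e) \<partial>count_space UNIV)"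
      by (intro nn_integral_mono ennreal_leI) (auto simp: indicator_def)
    also have "\<dots> = 1" by (rule nn_integral_pmf_eq_1)
    finally show "(\<integral>\<^sup>+e. ennreal (indicator (- B) e * pmf p e) \<partial>count_space UNIV) \<noteq> \<infinity>"
      by (auto simp: top_unique)
    show "AE x in count_space UNIV. ennreal (indicator (- B) x * pmf p x) \<le> ennreal (pmf r x)"
      using le by (auto intro!: ennreal_leI simp: indicator_def)
  qed simp_all
  also have "(\<integral>\<^sup>+e. ennreal (indicator (- B) e * pmf p e) \<partial>count_space UNIV) = emeasure (measure_pmf p) (- B)"
    unfolding nn_integral_pmf[symmetric]
    by (subst nn_integral_count_space_indicator) (auto intro!: nn_integral_cong simp: indicator_def)
  also have "(\<integral>\<^sup>+e. ennreal (pmf r e) \<partial>count_space UNIV) = 1" by (rule nn_integral_pmf_eq_1)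
  also have "ennreal (inverse b) * (1 - emeasure (measure_pmf p) (- B)) = 1"
  proof -
    have "emeasure (measure_pmf p) (- B) = ennreal (1 - b)"
      using measure_pmf.prob_compl[of B p] by (simp add: measure_pmf.emeasure_eq_measure b_def Compl_eq_Diff_UNIV)
    moreover have "b \<le> 1" by (simp add: b_def)
    then have "1 - ennreal (1 - b) = ennreal b"
      using ennreal_minus[of "1 - b" 1] by simp
    moreover have "ennreal (inverse b) * ennreal b = 1"
      using b ennreal_mult'[of "inverse b" b] by simp
    ultimately show ?thesis by simp
  qed
  finally have g1: "(\<integral>\<^sup>+e. ennreal (g e) \<partial>count_space UNIV) = 1" .
  define s where "s = embed_pmf g"
  have s: "pmf s e = g e" for e unfolding s_def by (rule pmf_embed_pmf[OF g0 g1])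
  define \<kappa> where "\<kappa> = bind_pmf p (\<lambda>x. if x \<in> B then map_pmf (Pair x) s else return_pmf (x, x))"
  have "map_pmf fst \<kappa> = bind_pmf p (\<lambda>x. return_pmf x)"
    unfolding \<kappa>_def map_bind_pmf by (intro bind_pmf_cong) (auto simp: pmf.map_comp o_def)
  then have 1: "map_pmf fst \<kappa> = p" by (simp add: bind_return_pmf')
  have 2: "map_pmf snd \<kappa> = bind_pmf p (\<lambda>x. if x \<in> B then s else return_pmf x)"
    unfolding \<kappa>_def map_bind_pmf by (intro bind_pmf_cong) (auto simp: pmf.map_comp o_def)
  have int: "integrable (measure_pmf p) (indicator A :: 'a \<Rightarrow> real)" for A
    by (rule integrable_real_indicator) (simp_all add: measure_pmf.emeasure_eq_measure)
  have "map_pmf snd \<kappa> = r"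
  proof (rule pmf_eqI)
    fix e
    have "pmf (map_pmf snd \<kappa>) e = (\<integral>x. g e * indicator B x + indicator (- B \<inter> {e}) x \<partial>measure_pmf p)"
      unfolding 2 pmf_bind by (intro Bochner_Integration.integral_cong) (auto simp: s indicator_def)
    also have "\<dots> = g e * b + measure_pmf.prob p (- B \<inter> {e})"
      by (subst Bochner_Integration.integral_add) (auto simp: b_def intro: int)
    also have "measure_pmf.prob p (- B \<inter> {e}) = indicator (- B) e * pmf p e"
      by (cases "e \<in> B") (auto simp: measure_pmf_single)
    also have "g e * b + \<dots> = pmf r e" using b by (simp add: g_def)
    finally show "pmf (map_pmf snd \<kappa>) e = pmf r e" .
  qed
  with 1 show ?thesis
    by (intro exI[of _ \<kappa>]) (auto simp: coupling_def \<kappa>_def split: if_splits)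
qed

text \<open>\<open>None\<close> is an idle draw that takes up the missing mass of a
  subprobability.\<close>

lemma ex_option_pmf:
  fixes q :: "'a \<Rightarrow> real"
  assumes "finite E" "\<And>e. e \<in> E \<Longrightarrow> 0 \<le> q e" "sum q E \<le> 1"
  shows "\<exists>p. set_pmf p \<subseteq> insert None (Some ` E) \<and> (\<forall>e\<in>E. pmf p (Some e) = q e)"
proof -
  define g where "g x = (case x of None \<Rightarrow> 1 - sum q E | Some e \<Rightarrow> if e \<in> E then q e else 0)" for x
  have g0: "g x \<ge> 0" for x using assms by (auto simp: g_def split: option.splits)
  have "(\<integral>\<^sup>+x. ennreal (g x) \<partial>count_space UNIV) = (\<integral>\<^sup>+x. ennreal (g x) \<partial>count_space (insert None (Some ` E)))"
    by (subst nn_integral_count_space_indicator)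
      (auto intro!: nn_integral_cong simp: g_def indicator_def split: option.splits)
  also have "\<dots> = ennreal (sum g (insert None (Some ` E)))"
    using assms(1) by (subst nn_integral_count_space_finite) (auto simp: g0)
  also have "sum g (insert None (Some ` E)) = 1"
    using assms(1) by (subst sum.insert) (auto simp: g_def sum.reindex)
  finally have g1: "(\<integral>\<^sup>+x. ennreal (g x) \<partial>count_space UNIV) = 1" by simp
  have "set_pmf (embed_pmf g) \<subseteq> insert None (Some ` E)"
    unfolding set_embed_pmf[OF g0 g1]
  proof
    fix x assume "x \<in> {x. g x \<noteq> 0}"
    then show "x \<in> insert None (Some ` E)" by (cases x) (auto simp: g_def split: if_splits)
  qed
  moreover have "\<forall>e\<in>E. pmf (embed_pmf g) (Some e) = q e"
    by (auto simp: pmf_embed_pmf[OF g0 g1] g_def)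
  ultimately show ?thesis by blast
qed

text \<open>The probability generating function of the Poisson law, from the exponential series at
  \<open>r * z\<close>.\<close>

lemma nn_integral_poisson_power:
  assumes "r > 0" "z \<ge> 0"
  shows "(\<integral>\<^sup>+k. ennreal (z ^ k) \<partial>poisson_pmf r) = ennreal (exp (r * (z - 1)))"
proof -
  have "(\<lambda>k. (r * z) ^ k /\<^sub>R fact k) sums exp (r * z)" by (rule exp_converges)
  then have "(\<lambda>k. exp (- r) * ((r * z) ^ k /\<^sub>R fact k)) sums (exp (- r) * exp (r * z))"
    by (rule sums_mult)
  moreover have "exp (- r) * exp (r * z) = exp (r * (z - 1))"
    by (simp add: exp_add[symmetric] algebra_simps)
  ultimately have s: "(\<lambda>k. r ^ k / fact k * exp (- r) * z ^ k) sums exp (r * (z - 1))"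
    by (simp add: power_mult_distrib divide_inverse mult_ac)
  have "(\<integral>\<^sup>+k. ennreal (z ^ k) \<partial>poisson_pmf r) =
      (\<integral>\<^sup>+k. ennreal (r ^ k / fact k * exp (- r) * z ^ k) \<partial>count_space UNIV)"
    unfolding nn_integral_measure_pmf
    using assms by (intro nn_integral_cong) (simp add: ennreal_mult[symmetric])
  also have "\<dots> = (\<Sum>k. ennreal (r ^ k / fact k * exp (- r) * z ^ k))"
    by (rule nn_integral_count_space_nat)
  also have "\<dots> = ennreal (exp (r * (z - 1)))"
    using assms by (intro suminf_ennreal_eq s) auto
  finally show ?thesis .
qed

text \<open>Chernoff's method: Markov's inequality for \<open>z ^ k\<close>, with \<open>z\<close>
  left free for the caller.\<close>

lemma prob_poisson_ge:
  assumes "r > 0" "z \<ge> 1"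
  shows "measure_pmf.prob (poisson_pmf r) {k. a \<le> real k} \<le> exp (r * (z - 1)) / z powr a"
proof -
  have "ennreal (measure_pmf.prob (poisson_pmf r) {k. a \<le> real k}) * ennreal (z powr a) =
      (\<integral>\<^sup>+k. ennreal (z powr a) * indicator {k. a \<le> real k} k \<partial>poisson_pmf r)"
    by (simp add: nn_integral_cmult measure_pmf.emeasure_eq_measure mult.commute)
  also have "\<dots> \<le> (\<integral>\<^sup>+k. ennreal (z ^ k) \<partial>poisson_pmf r)"
    using assms by (intro nn_integral_mono)
      (auto simp: indicator_def powr_realpow[symmetric] intro!: ennreal_leI powr_mono)
  also have "\<dots> = ennreal (exp (r * (z - 1)))"
    using assms by (intro nn_integral_poisson_power) auto
  finally have "measure_pmf.prob (poisson_pmf r) {k. a \<le> real k} * z powr a \<le> exp (r * (z - 1))"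
    by (simp add: ennreal_mult[symmetric])
  then show ?thesis using assms by (simp add: field_simps)
qed

lemma prob_bind_pmf_le:
  assumes "\<And>x. x \<in> set_pmf p \<Longrightarrow> x \<notin> B \<Longrightarrow> measure_pmf.prob (f x) A \<le> c" "c \<ge> 0"
  shows "measure_pmf.prob (bind_pmf p f) A \<le> measure_pmf.prob p B + c"
proof -
  have "emeasure (measure_pmf (bind_pmf p f)) A = (\<integral>\<^sup>+x. emeasure (measure_pmf (f x)) A \<partial>measure_pmf p)"
    by (rule emeasure_bind_pmf)
  also have "\<dots> \<le> (\<integral>\<^sup>+x. indicator B x + ennreal c \<partial>measure_pmf p)"
  proof (intro nn_integral_mono_AE AE_pmfI)
    fix x assume "x \<in> set_pmf p"
    show "emeasure (measure_pmf (f x)) A \<le> indicator B x + ennreal c"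
    proof (cases "x \<in> B")
      case True
      have "emeasure (measure_pmf (f x)) A \<le> 1" by (rule measure_pmf.emeasure_le_1)
      also have "1 \<le> 1 + ennreal c" by simp
      finally show ?thesis using True by simp
    next
      case False
      with \<open>x \<in> set_pmf p\<close> have "measure_pmf.prob (f x) A \<le> c" by (rule assms(1))
      with False show ?thesis by (simp add: measure_pmf.emeasure_eq_measure ennreal_leI)
    qed
  qed
  also have "\<dots> = ennreal (measure_pmf.prob p B + c)"
    using assms(2) by (subst nn_integral_add) (simp_all add: measure_pmf.emeasure_eq_measure)
  finally have "ennreal (measure_pmf.prob (bind_pmf p f) A) \<le> ennreal (measure_pmf.prob p B + c)"
    by (simp add: measure_pmf.emeasure_eq_measure)
  then show ?thesis by (subst (asm) ennreal_le_iff) (use assms(2) in simp_all)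
qed

section \<open>Revealing a random set in random order\<close>

text \<open>Every double count below takes this form: forgetting the marked subset, the next
  element, or which element came last is a \<open>c\<close>-to-one map.\<close>

lemma map_pmf_of_set_regular:
  assumes "finite A" "A \<noteq> {}" "\<And>a. a \<in> A \<Longrightarrow> f a \<in> B" "c > 0"
    and fib: "\<And>b. b \<in> B \<Longrightarrow> card {a \<in> A. f a = b} = c"
  shows "map_pmf f (pmf_of_set A) = pmf_of_set B"
proof -
  have img: "B = f ` A"
  proof
    show "B \<subseteq> f ` A"
    proof
      fix b assume "b \<in> B"
      then have "{a \<in> A. f a = b} \<noteq> {}" using fib \<open>c > 0\<close> by (metis card.empty less_irrefl)
      then show "b \<in> f ` A" by blast
    qed
  qed (use assms in auto)
  then have B: "finite B" "B \<noteq> {}" using assms by auto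
  have "card A = (\<Sum>b\<in>B. card {a \<in> A. f a = b})"
    using sum.image_gen[OF assms(1), of "\<lambda>_. 1::nat" f] by (simp add: img)
  also have "\<dots> = card B * c" using fib by simp
  finally have cA: "card A = card B * c" .
  show ?thesis
  proof (rule pmf_eqI)
    fix b
    have "pmf (map_pmf f (pmf_of_set A)) b = real (card (A \<inter> f -` {b})) / real (card A)"
      using assms by (simp add: pmf_map measure_pmf_of_set)
    also have "A \<inter> f -` {b} = {a \<in> A. f a = b}" by auto
    also have "real (card {a \<in> A. f a = b}) / real (card A) = pmf (pmf_of_set B) b"
    proof (cases "b \<in> B")
      case True
      then show ?thesis using B \<open>c > 0\<close> by (simp add: fib cA)
    next
      case False
      then have "{a \<in> A. f a = b} = {}" using assms by auto
      then show ?thesis using False B by (simp only: card.empty) simp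
    qed
    finally show "pmf (map_pmf f (pmf_of_set A)) b = pmf (pmf_of_set B) b" .
  qed
qed

text \<open>Disintegration of a uniform law: conditionally on the value of \<open>f\<close> the
  point is uniform on its fibre, whatever the sizes of the fibres.\<close>

lemma bind_pmf_of_set_fibres:
  assumes "finite A" "A \<noteq> {}"
  shows "bind_pmf (map_pmf f (pmf_of_set A)) (\<lambda>b. pmf_of_set {a \<in> A. f a = b}) = pmf_of_set A"
proof (rule pmf_eqI)
  fix x
  have "pmf (bind_pmf (map_pmf f (pmf_of_set A)) (\<lambda>b. pmf_of_set {a \<in> A. f a = b})) x
      = (\<Sum>y\<in>A. pmf (pmf_of_set {a \<in> A. f a = f y}) x) / card A"
    using assms unfolding bind_map_pmf by (simp add: pmf_bind_pmf_of_set)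
  also have "(\<Sum>y\<in>A. pmf (pmf_of_set {a \<in> A. f a = f y}) x)
      = (\<Sum>y\<in>A. indicator {a \<in> A. f a = f y} x / card {a \<in> A. f a = f y})"
  proof (rule sum.cong)
    fix y assume "y \<in> A"
    then have "{a \<in> A. f a = f y} \<noteq> {}" "finite {a \<in> A. f a = f y}" using assms by auto
    then show "pmf (pmf_of_set {a \<in> A. f a = f y}) x = indicator {a \<in> A. f a = f y} x / card {a \<in> A. f a = f y}"
      by simp
  qed simp
  also have "\<dots> = indicator A x"
  proof (cases "x \<in> A")
    case True
    then have ne: "card {a \<in> A. f a = f x} > 0" using assms by (auto simp: card_gt_0_iff)
    have "(\<Sum>y\<in>A. indicator {a \<in> A. f a = f y} x / card {a \<in> A. f a = f y})
        = (\<Sum>y\<in>{a \<in> A. f a = f x}. 1 / real (card {a \<in> A. f a = f x}))"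
      using True assms(1) by (intro sum.mono_neutral_cong_right) (auto simp: indicator_def)
    then show ?thesis using True ne by simp
  qed (simp add: indicator_def)
  finally show "pmf (bind_pmf (map_pmf f (pmf_of_set A)) (\<lambda>b. pmf_of_set {a \<in> A. f a = b})) x = pmf (pmf_of_set A) x"
    using assms by simp
qed

text \<open>If the elements of a uniformly random member of \<open>\<Omega>\<close> are revealed in uniformly random order,
  then \<open>revealed \<Omega> k\<close> is the law of the set of the first \<open>k\<close> of them, and \<open>next_elem \<Omega> H\<close> is the
  law of the next one given that \<open>H\<close> has been revealed.\<close>

definition extensions :: "'a set set \<Rightarrow> 'a set \<Rightarrow> 'a set set" where
  "extensions \<Omega> H = {G \<in> \<Omega>. H \<subseteq> G}"

text \<open>Orderings are avoided: the first \<open>k\<close> elements of a uniformly ordered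
  \<open>G\<close> form a uniform \<open>k\<close>-subset, so a uniform pair (\<open>H\<close>,
  \<open>G\<close>) carries all that is needed at one time.\<close>

definition marked :: "'a set set \<Rightarrow> nat \<Rightarrow> ('a set \<times> 'a set) set" where
  "marked \<Omega> k = {(H, G). G \<in> \<Omega> \<and> H \<subseteq> G \<and> card H = k}"

definition revealed :: "'a set set \<Rightarrow> nat \<Rightarrow> 'a set pmf" where
  "revealed \<Omega> k = map_pmf fst (pmf_of_set (marked \<Omega> k))"

definition next_elem :: "'a set set \<Rightarrow> 'a set \<Rightarrow> 'a pmf" where
  "next_elem \<Omega> H = bind_pmf (pmf_of_set (extensions \<Omega> H)) (\<lambda>G. pmf_of_set (G - H))"

text \<open>Independent draws with replacement, remembered only as a set, so that repetitions
  collapse and idle draws leave no trace.\<close>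

primrec draws :: "'a option pmf \<Rightarrow> nat \<Rightarrow> 'a set pmf" where
  "draws p 0 = return_pmf {}"
| "draws p (Suc k) = bind_pmf (draws p k) (\<lambda>F. map_pmf (\<lambda>x. F \<union> set_option x) p)"

lemma set_draws:
  assumes "set_pmf p \<subseteq> insert None (Some ` E)"
  shows "set_pmf (draws p k) \<subseteq> Pow E"
proof (induction k)
  case (Suc k)
  have "set_option x \<subseteq> E" if "x \<in> set_pmf p" for x using assms that by auto
  with Suc show ?case by fastforce
qed simp

text \<open>The union stays inside \<open>S\<close> exactly if each of the independent draws is idle
  or lies in \<open>S\<close>.\<close>

lemma emeasure_draws_Pow:
  "emeasure (measure_pmf (draws p k)) (Pow S) =
    ennreal (measure_pmf.prob p (insert None (Some ` S)) ^ k)"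
proof (induction k)
  case 0
  then show ?case by simp
next
  case (Suc k)
  define b where "b = measure_pmf.prob p (insert None (Some ` S))"
  have *: "emeasure (measure_pmf (map_pmf (\<lambda>x. F \<union> set_option x) p)) (Pow S) = ennreal b * indicator (Pow S) F" for F
  proof (cases "F \<subseteq> S")
    case True
    then have "(\<lambda>x. F \<union> set_option x) -` Pow S = {x. set_option x \<subseteq> S}" by auto
    also have "\<dots> = insert None (Some ` S)"
    proof -
      have "set_option x \<subseteq> S \<longleftrightarrow> x \<in> insert None (Some ` S)" for x by (cases x) auto
      then show ?thesis by blast
    qed
    finally show ?thesis using True by (simp add: b_def measure_pmf.emeasure_eq_measure)
  next
    case False
    then have "(\<lambda>x. F \<union> set_option x) -` Pow S = {}" by auto
    then show ?thesis using False by simp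
  qed
  have "emeasure (measure_pmf (draws p (Suc k))) (Pow S) = ennreal b * emeasure (measure_pmf (draws p k)) (Pow S)"
    by (simp only: draws.simps emeasure_bind_pmf *) (simp add: nn_integral_cmult)
  also have "\<dots> = ennreal (b ^ Suc k)"
    unfolding Suc b_def[symmetric] by (simp add: ennreal_mult' b_def)
  finally show ?case by (simp add: b_def)
qed

text \<open>Poisson thinning in terms of avoidance probabilities: the generating function turns a
  \<open>k\<close>-th power into an exponential of a sum over \<open>E - S\<close>, hence into a
  product over elements. This is the independence gained from randomising the number of
  draws.\<close>

lemma poisson_draws_Pow:
  assumes "finite E" and p: "set_pmf p \<subseteq> insert None (Some ` E)" "\<And>e. e \<in> E \<Longrightarrow> pmf p (Some e) = q e"
    and "r > 0" "S \<subseteq> E"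
  shows "measure_pmf.prob (bind_pmf (poisson_pmf r) (draws p)) (Pow S) = exp (- r * sum q (E - S))"
proof -
  define b where "b = measure_pmf.prob p (insert None (Some ` S))"
  have "b = 1 - measure_pmf.prob p (- insert None (Some ` S))"
    using measure_pmf.prob_compl[of "insert None (Some ` S)" p] by (simp add: b_def Compl_eq_Diff_UNIV)
  also have "measure_pmf.prob p (- insert None (Some ` S)) = measure_pmf.prob p (Some ` (E - S))"
    using p(1) by (intro measure_pmf.finite_measure_eq_AE) (auto intro!: AE_pmfI)
  also have "\<dots> = sum q (E - S)"
    using assms(1) by (subst measure_measure_pmf_finite) (auto simp: sum.reindex p(2))
  finally have b: "b = 1 - sum q (E - S)" .
  have "emeasure (measure_pmf (bind_pmf (poisson_pmf r) (draws p))) (Pow S) = (\<integral>\<^sup>+k. ennreal (b ^ k) \<partial>poisson_pmf r)"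
    by (simp add: emeasure_bind_pmf emeasure_draws_Pow b_def)
  also have "\<dots> = ennreal (exp (r * (b - 1)))"
    using \<open>r > 0\<close> by (intro nn_integral_poisson_power) (auto simp: b_def)
  finally show ?thesis by (simp add: measure_pmf.emeasure_eq_measure b)
qed

context
  fixes \<Omega> :: "'a set set" and E :: "'a set" and m :: nat
  assumes fin: "finite E" and sub: "\<Omega> \<subseteq> Pow E" and ne: "\<Omega> \<noteq> {}"
    and card: "\<And>G. G \<in> \<Omega> \<Longrightarrow> card G = m"
begin

lemma finite_member: "G \<in> \<Omega> \<Longrightarrow> finite G"
  using fin sub finite_subset by blast

lemma finite_family: "finite \<Omega>"
  using fin sub finite_subset by blast

lemma finite_extensions: "finite (extensions \<Omega> H)"
  using finite_family by (simp add: extensions_def)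

lemma finite_marked: "finite (marked \<Omega> k)"
  by (rule finite_subset[of _ "Pow E \<times> Pow E"]) (use fin sub in \<open>auto simp: marked_def\<close>)

lemma card_subsets: "G \<in> \<Omega> \<Longrightarrow> card {H. H \<subseteq> G \<and> card H = k} = m choose k"
  using n_subsets[of G k] card finite_member by simp

lemma marked_nonempty: "k \<le> m \<Longrightarrow> marked \<Omega> k \<noteq> {}"
proof -
  assume "k \<le> m"
  obtain G where G: "G \<in> \<Omega>" using ne by blast
  with \<open>k \<le> m\<close> card obtain H where "H \<subseteq> G" "card H = k" by (metis obtain_subset_with_card_n)
  with G show ?thesis by (auto simp: marked_def)
qed

text \<open>All members have the same size \<open>m\<close>, hence equally many marks; a uniform
  pair therefore has a uniform second component.\<close>

lemma snd_marked:
  assumes "k \<le> m"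
  shows "map_pmf snd (pmf_of_set (marked \<Omega> k)) = pmf_of_set \<Omega>"
proof (rule map_pmf_of_set_regular[where c = "m choose k"])
  fix G assume "G \<in> \<Omega>"
  then have "{a \<in> marked \<Omega> k. snd a = G} = (\<lambda>H. (H, G)) ` {H. H \<subseteq> G \<and> card H = k}"
    by (auto simp: marked_def)
  then show "card {a \<in> marked \<Omega> k. snd a = G} = m choose k"
    using card_subsets[OF \<open>G \<in> \<Omega>\<close>] by (simp add: card_image inj_on_def)
qed (use finite_marked marked_nonempty assms in \<open>auto simp: marked_def\<close>)

lemma set_revealed:
  assumes "k \<le> m" "H \<in> set_pmf (revealed \<Omega> k)"
  shows "card H = k" "extensions \<Omega> H \<noteq> {}"
  using assms finite_marked marked_nonempty[OF assms(1)]
  by (auto simp: revealed_def marked_def extensions_def)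

text \<open>The fibre of \<open>marked\<close> over \<open>H\<close> is a copy of
  \<open>extensions \<Omega> H\<close>, so completing \<open>H\<close> uniformly restores the
  uniform pair.\<close>

lemma revealed_extend:
  assumes "k \<le> m"
  shows "bind_pmf (revealed \<Omega> k) (\<lambda>H. map_pmf (Pair H) (pmf_of_set (extensions \<Omega> H))) = pmf_of_set (marked \<Omega> k)"
proof -
  have "bind_pmf (revealed \<Omega> k) (\<lambda>H. map_pmf (Pair H) (pmf_of_set (extensions \<Omega> H)))
      = bind_pmf (revealed \<Omega> k) (\<lambda>H. pmf_of_set {a \<in> marked \<Omega> k. fst a = H})"
  proof (intro bind_pmf_cong refl)
    fix H assume H: "H \<in> set_pmf (revealed \<Omega> k)"
    note H' = set_revealed[OF assms H]
    have "map_pmf (Pair H) (pmf_of_set (extensions \<Omega> H)) = pmf_of_set (Pair H ` extensions \<Omega> H)"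
      using H' finite_extensions by (intro map_pmf_of_set_inj) (auto simp: inj_on_def)
    also have "Pair H ` extensions \<Omega> H = {a \<in> marked \<Omega> k. fst a = H}"
      unfolding marked_def extensions_def H'(1)[symmetric] by auto
    finally show "map_pmf (Pair H) (pmf_of_set (extensions \<Omega> H)) = pmf_of_set {a \<in> marked \<Omega> k. fst a = H}" .
  qed
  also have "\<dots> = pmf_of_set (marked \<Omega> k)"
    unfolding revealed_def by (rule bind_pmf_of_set_fibres[OF finite_marked marked_nonempty[OF assms]])
  finally show ?thesis .
qed

text \<open>Count triples (\<open>H\<close>, \<open>G\<close>, \<open>e\<close>) with
  \<open>e\<close> in \<open>G - H\<close>. Forgetting \<open>e\<close> is (m - k)-to-one; moving
  \<open>e\<close> into \<open>H\<close> is (k + 1)-to-one, as any element of the larger set may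
  have come last. Both images are therefore uniform.\<close>

lemma revealed_Suc:
  assumes "k < m"
  shows "bind_pmf (revealed \<Omega> k) (\<lambda>H. map_pmf (\<lambda>e. insert e H) (next_elem \<Omega> H)) = revealed \<Omega> (Suc k)"
proof -
  define T where "T = Sigma (marked \<Omega> k) (\<lambda>(H, G). G - H)"
  have finT: "finite T" unfolding T_def using finite_marked finite_member by (auto simp: marked_def)
  have fibT: "{t \<in> T. fst t = x} = Pair x ` (snd x - fst x)" if "x \<in> marked \<Omega> k" for x
    using that by (auto simp: T_def split: prod.splits)
  have cardD: "card (snd x - fst x) = m - k" if "x \<in> marked \<Omega> k" for x
    using that card finite_member by (auto simp: marked_def card_Diff_subset finite_subset)
  have neT: "T \<noteq> {}"
  proof -
    obtain x where x: "x \<in> marked \<Omega> k" using marked_nonempty assms by (meson equals0I less_imp_le)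
    then have "snd x - fst x \<noteq> {}" using cardD[OF x] assms by (metis card.empty less_irrefl zero_less_diff)
    then obtain y where "y \<in> snd x - fst x" by blast
    with x have "(x, y) \<in> T" by (simp add: T_def case_prod_beta)
    then show ?thesis by blast
  qed
  have mapT: "map_pmf fst (pmf_of_set T) = pmf_of_set (marked \<Omega> k)"
  proof (rule map_pmf_of_set_regular[where c = "m - k"])
    fix x assume "x \<in> marked \<Omega> k"
    then show "card {a \<in> T. fst a = x} = m - k"
      by (simp add: fibT cardD card_image inj_on_def)
  qed (use finT neT assms in \<open>auto simp: T_def\<close>)
  have "bind_pmf (pmf_of_set (marked \<Omega> k)) (\<lambda>x. map_pmf (Pair x) (pmf_of_set (snd x - fst x)))
      = bind_pmf (map_pmf fst (pmf_of_set T)) (\<lambda>x. pmf_of_set {t \<in> T. fst t = x})"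
    unfolding mapT
  proof (intro bind_pmf_cong refl)
    fix x assume "x \<in> set_pmf (pmf_of_set (marked \<Omega> k))"
    then have x: "x \<in> marked \<Omega> k" using finite_marked marked_nonempty assms by simp
    then have "snd x - fst x \<noteq> {}" "finite (snd x - fst x)"
      using cardD[OF x] assms finite_member by (metis card.empty less_irrefl zero_less_diff, auto simp: marked_def)
    then show "map_pmf (Pair x) (pmf_of_set (snd x - fst x)) = pmf_of_set {t \<in> T. fst t = x}"
      by (subst fibT[OF x]) (intro map_pmf_of_set_inj, auto simp: inj_on_def)
  qed
  also have "\<dots> = pmf_of_set T" by (rule bind_pmf_of_set_fibres[OF finT neT])
  finally have T: "pmf_of_set T = bind_pmf (pmf_of_set (marked \<Omega> k)) (\<lambda>x. map_pmf (Pair x) (pmf_of_set (snd x - fst x)))" ..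
  have "bind_pmf (revealed \<Omega> k) (\<lambda>H. map_pmf (\<lambda>e. insert e H) (next_elem \<Omega> H))
      = bind_pmf (bind_pmf (revealed \<Omega> k) (\<lambda>H. map_pmf (Pair H) (pmf_of_set (extensions \<Omega> H))))
          (\<lambda>x. map_pmf (\<lambda>e. insert e (fst x)) (pmf_of_set (snd x - fst x)))"
    by (simp add: next_elem_def map_bind_pmf bind_assoc_pmf bind_map_pmf)
  also have "\<dots> = map_pmf (\<lambda>t. insert (snd t) (fst (fst t))) (pmf_of_set T)"
    using assms unfolding T by (simp add: revealed_extend map_bind_pmf pmf.map_comp o_def)
  also have "\<dots> = map_pmf fst (map_pmf (\<lambda>t. (insert (snd t) (fst (fst t)), snd (fst t))) (pmf_of_set T))"
    by (simp add: pmf.map_comp o_def)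
  also have "map_pmf (\<lambda>t. (insert (snd t) (fst (fst t)), snd (fst t))) (pmf_of_set T) = pmf_of_set (marked \<Omega> (Suc k))"
  proof (rule map_pmf_of_set_regular[OF finT neT, where c = "Suc k"])
    fix t assume "t \<in> T"
    then show "(insert (snd t) (fst (fst t)), snd (fst t)) \<in> marked \<Omega> (Suc k)"
      using finite_member finite_subset by (fastforce simp: T_def marked_def)
  next
    fix b assume b: "b \<in> marked \<Omega> (Suc k)"
    obtain H G where HG: "b = (H, G)" by (cases b)
    with b have *: "G \<in> \<Omega>" "H \<subseteq> G" "card H = Suc k" "finite H"
      using finite_member finite_subset by (auto simp: marked_def)
    have "{t \<in> T. (insert (snd t) (fst (fst t)), snd (fst t)) = b} = (\<lambda>e. ((H - {e}, G), e)) ` H"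
      using * by (auto simp: T_def marked_def HG image_iff)
    then show "card {t \<in> T. (insert (snd t) (fst (fst t)), snd (fst t)) = b} = Suc k"
      using * by (simp add: card_image inj_on_def)
  qed simp
  finally show ?thesis by (simp add: revealed_def)
qed

text \<open>A uniform extension shows \<open>e\<close> next with chance 1 / (m - |H|) if it contains
  \<open>e\<close>, and never otherwise. The ratio of extension counts is what the switching
  estimates.\<close>

lemma pmf_next_elem:
  assumes "extensions \<Omega> H \<noteq> {}" "card H < m" "e \<notin> H"
  shows "pmf (next_elem \<Omega> H) e = card (extensions \<Omega> (insert e H)) / (card (extensions \<Omega> H) * (m - card H))"
proof -
  have "pmf (next_elem \<Omega> H) e = (\<Sum>G\<in>extensions \<Omega> H. pmf (pmf_of_set (G - H)) e) / card (extensions \<Omega> H)"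
    unfolding next_elem_def using assms finite_extensions by (simp add: pmf_bind_pmf_of_set)
  also have "(\<Sum>G\<in>extensions \<Omega> H. pmf (pmf_of_set (G - H)) e)
      = (\<Sum>G\<in>extensions \<Omega> H. indicator (extensions \<Omega> (insert e H)) G / real (m - card H))"
  proof (rule sum.cong)
    fix G assume G: "G \<in> extensions \<Omega> H"
    then have "card (G - H) = m - card H" "finite (G - H)"
      using card finite_member by (auto simp: extensions_def card_Diff_subset finite_subset)
    moreover from this have "G - H \<noteq> {}" using assms(2) by (metis card.empty less_irrefl zero_less_diff)
    ultimately have "pmf (pmf_of_set (G - H)) e = indicator (G - H) e / real (m - card H)" by simp
    then show "pmf (pmf_of_set (G - H)) e = indicator (extensions \<Omega> (insert e H)) G / real (m - card H)"
      using G assms(3) by (auto simp: extensions_def indicator_def)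
  qed simp
  also have "\<dots> = card (extensions \<Omega> H \<inter> extensions \<Omega> (insert e H)) / real (m - card H)"
    unfolding sum_divide_distrib[symmetric] using finite_extensions by (simp add: indicator_def sum_of_bool_eq)
  also have "extensions \<Omega> H \<inter> extensions \<Omega> (insert e H) = extensions \<Omega> (insert e H)"
    by (auto simp: extensions_def)
  finally show ?thesis by (simp add: field_simps)
qed

text \<open>Induction on time, with one step of \<open>ex_coupling_off\<close> on top of the
  coupling so far. An element of \<open>E\<close> outside \<open>H\<close> is dominated by the next
  revealed one, and an element of \<open>H\<close> is already covered, so inclusion can break only
  at a time when the history is not \<open>good\<close>.\<close>

lemma ex_coupling_draws_revealed:
  assumes p: "set_pmf p \<subseteq> insert None (Some ` E)"
    and rate: "\<And>H e. card H < K \<Longrightarrow> extensions \<Omega> H \<noteq> {} \<Longrightarrow> good H \<Longrightarrow> e \<in> E - H \<Longrightarrow>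
      pmf p (Some e) \<le> pmf (next_elem \<Omega> H) e"
    and "K \<le> m" "k \<le> K"
  shows "\<exists>\<nu>. coupling \<nu> (draws p k) (revealed \<Omega> k) \<and>
    measure_pmf.prob \<nu> {(F, H). \<not> F \<subseteq> H} \<le> (\<Sum>i<k. measure_pmf.prob (revealed \<Omega> i) {H. \<not> good H})"
  using \<open>k \<le> K\<close>
proof (induction k)
  case 0
  then show ?case
    by (intro exI[of _ "map_pmf (\<lambda>H. ({}, H)) (revealed \<Omega> 0)"])
      (auto simp: coupling_def pmf.map_comp o_def map_pmf_const)
next
  case (Suc k)
  then obtain \<nu> where \<nu>: "map_pmf fst \<nu> = draws p k" "map_pmf snd \<nu> = revealed \<Omega> k"
    and le: "measure_pmf.prob \<nu> {(F, H). \<not> F \<subseteq> H} \<le> (\<Sum>i<k. measure_pmf.prob (revealed \<Omega> i) {H. \<not> good H})"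
    by (auto simp: coupling_def)
  have km: "k \<le> m" "k < m" "k < K" using Suc.prems \<open>K \<le> m\<close> by auto
  have ex: "\<exists>\<kappa>. coupling \<kappa> p (map_pmf Some (next_elem \<Omega> H)) \<and>
      (good H \<longrightarrow> (\<forall>(x, y)\<in>set_pmf \<kappa>. x \<in> insert None (Some ` H) \<or> x = y))"
    if "H \<in> set_pmf (revealed \<Omega> k)" for H
  proof (cases "good H")
    case True
    have "\<exists>\<kappa>. coupling \<kappa> p (map_pmf Some (next_elem \<Omega> H)) \<and>
        (\<forall>(x, y)\<in>set_pmf \<kappa>. x \<in> insert None (Some ` H) \<or> x = y)"
    proof (rule ex_coupling_off)
      fix x assume x: "x \<notin> insert None (Some ` H)"
      then obtain e where e: "x = Some e" "e \<notin> H" by (cases x) auto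
      show "pmf p x \<le> pmf (map_pmf Some (next_elem \<Omega> H)) x"
      proof (cases "e \<in> E")
        case True
        have "pmf p x \<le> pmf (next_elem \<Omega> H) e"
          unfolding e(1) using set_revealed[OF km(1) that] km True e \<open>good H\<close> by (intro rate) auto
        then show ?thesis by (simp add: e(1) pmf_map_inj')
      next
        case False
        then have "pmf p x = 0" using p e by (auto simp: set_pmf_iff)
        then show ?thesis by simp
      qed
    qed
    then show ?thesis by blast
  next
    case False
    then show ?thesis
      \<comment> \<open>After a bad history only the marginals matter, and the independent pair has
        them.\<close>
      by (intro exI[of _ "pair_pmf p (map_pmf Some (next_elem \<Omega> H))"])
        (simp add: coupling_def map_fst_pair_pmf map_snd_pair_pmf)
  qed
  have "\<forall>H\<in>set_pmf (revealed \<Omega> k). \<exists>\<kappa>. coupling \<kappa> p (map_pmf Some (next_elem \<Omega> H)) \<and>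
      (good H \<longrightarrow> (\<forall>(x, y)\<in>set_pmf \<kappa>. x \<in> insert None (Some ` H) \<or> x = y))"
    using ex by blast
  from bchoice[OF this] obtain \<kappa> where
    "\<forall>H\<in>set_pmf (revealed \<Omega> k). coupling (\<kappa> H) p (map_pmf Some (next_elem \<Omega> H)) \<and>
      (good H \<longrightarrow> (\<forall>(x, y)\<in>set_pmf (\<kappa> H). x \<in> insert None (Some ` H) \<or> x = y))"
    by blast
  then have \<kappa>: "\<And>H. H \<in> set_pmf (revealed \<Omega> k) \<Longrightarrow> map_pmf fst (\<kappa> H) = p"
      "\<And>H. H \<in> set_pmf (revealed \<Omega> k) \<Longrightarrow> map_pmf snd (\<kappa> H) = map_pmf Some (next_elem \<Omega> H)"
      "\<And>H x y. H \<in> set_pmf (revealed \<Omega> k) \<Longrightarrow> good H \<Longrightarrow> (x, y) \<in> set_pmf (\<kappa> H) \<Longrightarrow> x \<in> insert None (Some ` H) \<or> x = y"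
    unfolding coupling_def by (simp_all only: case_prod_beta) (drule bspec, assumption, auto)+
  define \<nu>' where "\<nu>' = bind_pmf \<nu> (\<lambda>s. map_pmf (\<lambda>t. (fst s \<union> set_option (fst t), snd s \<union> set_option (snd t))) (\<kappa> (snd s)))"
  have supp: "snd s \<in> set_pmf (revealed \<Omega> k)" if "s \<in> set_pmf \<nu>" for s
    using that \<nu>(2) by (metis imageI set_map_pmf)
  have "map_pmf fst \<nu>' = bind_pmf \<nu> (\<lambda>s. map_pmf (\<lambda>x. fst s \<union> set_option x) (map_pmf fst (\<kappa> (snd s))))"
    unfolding \<nu>'_def map_bind_pmf by (simp add: pmf.map_comp o_def)
  also have "\<dots> = bind_pmf \<nu> (\<lambda>s. map_pmf (\<lambda>x. fst s \<union> set_option x) p)"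
    using supp by (intro bind_pmf_cong) (simp_all add: \<kappa>(1))
  also have "\<dots> = bind_pmf (map_pmf fst \<nu>) (\<lambda>F. map_pmf (\<lambda>x. F \<union> set_option x) p)"
    by (simp add: bind_map_pmf)
  finally have 1: "map_pmf fst \<nu>' = draws p (Suc k)" by (simp add: \<nu>)
  have "map_pmf snd \<nu>' = bind_pmf \<nu> (\<lambda>s. map_pmf (\<lambda>y. snd s \<union> set_option y) (map_pmf snd (\<kappa> (snd s))))"
    unfolding \<nu>'_def map_bind_pmf by (simp add: pmf.map_comp o_def)
  also have "\<dots> = bind_pmf \<nu> (\<lambda>s. map_pmf (\<lambda>e. insert e (snd s)) (next_elem \<Omega> (snd s)))"
    using supp by (intro bind_pmf_cong) (simp_all add: \<kappa>(2) pmf.map_comp o_def)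
  also have "\<dots> = bind_pmf (map_pmf snd \<nu>) (\<lambda>H. map_pmf (\<lambda>e. insert e H) (next_elem \<Omega> H))"
    by (simp add: bind_map_pmf)
  finally have 2: "map_pmf snd \<nu>' = revealed \<Omega> (Suc k)" by (simp add: \<nu> revealed_Suc km)
  \<comment> \<open>A failure after this step comes from an earlier failure or from a bad history
    now; the second event is the new summand of the bound.\<close>
  define bad where "bad = {s. \<not> fst s \<subseteq> snd s} \<union> {s. \<not> good (snd s)}"
  have "measure_pmf.prob \<nu>' {(F, H). \<not> F \<subseteq> H} \<le> measure_pmf.prob \<nu> bad + 0"
    unfolding \<nu>'_def
  proof (rule prob_bind_pmf_le)
    fix s assume s: "s \<in> set_pmf \<nu>" "s \<notin> bad"
    have "fst s \<union> set_option (fst t) \<subseteq> snd s \<union> set_option (snd t)" if "t \<in> set_pmf (\<kappa> (snd s))" for t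
      using \<kappa>(3)[OF supp[OF s(1)], of "fst t" "snd t"] s(2) that by (auto simp: bad_def)
    then show "measure_pmf.prob (map_pmf (\<lambda>t. (fst s \<union> set_option (fst t), snd s \<union> set_option (snd t))) (\<kappa> (snd s)))
        {(F, H). \<not> F \<subseteq> H} \<le> 0"
      by (simp add: measure_pmf_zero_iff disjoint_iff measure_le_0_iff)
  qed simp
  also have "measure_pmf.prob \<nu> bad + 0 \<le> measure_pmf.prob \<nu> {s. \<not> fst s \<subseteq> snd s} + measure_pmf.prob \<nu> {s. \<not> good (snd s)}"
    unfolding bad_def by (simp add: measure_Un_le)
  also have "measure_pmf.prob \<nu> {s. \<not> good (snd s)} = measure_pmf.prob (revealed \<Omega> k) {H. \<not> good H}"
    unfolding \<nu>(2)[symmetric] by (simp add: vimage_def)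
  also have "{s. \<not> fst s \<subseteq> snd s} = {(F, H). \<not> F \<subseteq> H}" by auto
  finally show ?case using le 1 2 by (intro exI[of _ \<nu>']) (auto simp: coupling_def)
qed

text \<open>No joint coupling over all times is needed: given the Poisson number \<open>k\<close> of draws, couple with the
  first \<open>k\<close> revealed elements and then complete these to a uniform member of \<open>\<Omega>\<close>.\<close>

lemma ex_coupling_poisson_draws:
  assumes p: "set_pmf p \<subseteq> insert None (Some ` E)"
    and rate: "\<And>H e. card H < K \<Longrightarrow> extensions \<Omega> H \<noteq> {} \<Longrightarrow> good H \<Longrightarrow> e \<in> E - H \<Longrightarrow>
      pmf p (Some e) \<le> pmf (next_elem \<Omega> H) e"
    and "K \<le> m"
  shows "\<exists>\<mu>. coupling \<mu> (bind_pmf (poisson_pmf r) (draws p)) (pmf_of_set \<Omega>) \<and>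
    measure_pmf.prob \<mu> {(F, G). \<not> F \<subseteq> G} \<le> measure_pmf.prob (poisson_pmf r) {k. K < k} +
      (\<Sum>i<K. measure_pmf.prob (revealed \<Omega> i) {H. \<not> good H})"
proof -
  have "\<exists>\<nu>. k \<le> K \<longrightarrow> coupling \<nu> (draws p k) (revealed \<Omega> k) \<and>
    measure_pmf.prob \<nu> {(F, H). \<not> F \<subseteq> H} \<le> (\<Sum>i<k. measure_pmf.prob (revealed \<Omega> i) {H. \<not> good H})" for k
    using ex_coupling_draws_revealed[OF p rate \<open>K \<le> m\<close>] by blast
  then obtain \<nu> where \<nu>: "\<And>k. k \<le> K \<Longrightarrow> map_pmf fst (\<nu> k) = draws p k" "\<And>k. k \<le> K \<Longrightarrow> map_pmf snd (\<nu> k) = revealed \<Omega> k"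
    "\<And>k. k \<le> K \<Longrightarrow> measure_pmf.prob (\<nu> k) {(F, H). \<not> F \<subseteq> H} \<le> (\<Sum>i<k. measure_pmf.prob (revealed \<Omega> i) {H. \<not> good H})"
    unfolding coupling_def by metis
  \<comment> \<open>The second marginal must be uniform for every single \<open>k\<close>, so that
    mixing over \<open>k\<close> preserves it. Too many draws are paired independently and charged
    to the Poisson tail.\<close>
  define \<xi> where "\<xi> k = (if k \<le> K then bind_pmf (\<nu> k) (\<lambda>s. map_pmf (Pair (fst s)) (pmf_of_set (extensions \<Omega> (snd s))))
    else pair_pmf (draws p k) (pmf_of_set \<Omega>))" for k
  have f: "map_pmf fst (\<xi> k) = draws p k" for k
  proof (cases "k \<le> K")
    case True
    have "map_pmf fst (\<xi> k) = bind_pmf (\<nu> k) (\<lambda>s. return_pmf (fst s))"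
      using True by (simp add: \<xi>_def map_bind_pmf pmf.map_comp o_def map_pmf_const)
    then show ?thesis using \<nu>(1)[OF True] by (simp add: map_pmf_def)
  qed (simp add: \<xi>_def map_fst_pair_pmf)
  have s: "map_pmf snd (\<xi> k) = pmf_of_set \<Omega>" for k
  proof (cases "k \<le> K")
    case True
    have "map_pmf snd (\<xi> k) = bind_pmf (map_pmf snd (\<nu> k)) (\<lambda>H. pmf_of_set (extensions \<Omega> H))"
      using True by (simp add: \<xi>_def map_bind_pmf bind_map_pmf pmf.map_comp o_def)
    also have "\<dots> = map_pmf snd (bind_pmf (revealed \<Omega> k) (\<lambda>H. map_pmf (Pair H) (pmf_of_set (extensions \<Omega> H))))"
      using \<nu>(2)[OF True] by (simp add: map_bind_pmf pmf.map_comp o_def)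
    also have "\<dots> = pmf_of_set \<Omega>"
      using True \<open>K \<le> m\<close> by (simp add: revealed_extend snd_marked)
    finally show ?thesis .
  qed (simp add: \<xi>_def map_snd_pair_pmf)
  define b where "b = (\<Sum>i<K. measure_pmf.prob (revealed \<Omega> i) {H. \<not> good H})"
  have bnd: "measure_pmf.prob (\<xi> k) {(F, G). \<not> F \<subseteq> G} \<le> b" if "k \<le> K" for k
  proof -
    have "measure_pmf.prob (\<xi> k) {(F, G). \<not> F \<subseteq> G} \<le> measure_pmf.prob (\<nu> k) {(F, H). \<not> F \<subseteq> H} + 0"
      unfolding \<xi>_def if_P[OF that]
    proof (rule prob_bind_pmf_le)
      fix t assume t: "t \<in> set_pmf (\<nu> k)" "t \<notin> {(F, H). \<not> F \<subseteq> H}"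
      have "snd t \<in> set_pmf (revealed \<Omega> k)" using t(1) \<nu>(2)[OF that] by (metis imageI set_map_pmf)
      then have "extensions \<Omega> (snd t) \<noteq> {}" using set_revealed that \<open>K \<le> m\<close> by (meson order_trans)
      then have "set_pmf (pmf_of_set (extensions \<Omega> (snd t))) = extensions \<Omega> (snd t)"
        using finite_extensions by simp
      then show "measure_pmf.prob (map_pmf (Pair (fst t)) (pmf_of_set (extensions \<Omega> (snd t)))) {(F, G). \<not> F \<subseteq> G} \<le> 0"
        using t(2) by (auto simp: measure_pmf_zero_iff measure_le_0_iff extensions_def) (meson subsetD)
    qed simp
    also have "\<dots> \<le> b"
      using \<nu>(3)[OF that] sum_mono2[of "{..<K}" "{..<k}" "\<lambda>i. measure_pmf.prob (revealed \<Omega> i) {H. \<not> good H}"] that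
      by (force simp: b_def)
    finally show ?thesis .
  qed
  define \<mu> where "\<mu> = bind_pmf (poisson_pmf r) \<xi>"
  have "coupling \<mu> (bind_pmf (poisson_pmf r) (draws p)) (pmf_of_set \<Omega>)"
    by (simp add: coupling_def \<mu>_def map_bind_pmf f s)
  moreover have "measure_pmf.prob \<mu> {(F, G). \<not> F \<subseteq> G} \<le> measure_pmf.prob (poisson_pmf r) {k. K < k} + b"
    unfolding \<mu>_def
  proof (rule prob_bind_pmf_le)
    show "measure_pmf.prob (\<xi> k) {(F, G). \<not> F \<subseteq> G} \<le> b" if "k \<notin> {k. K < k}" for k
      using that by (intro bnd) simp
  qed (simp add: b_def sum_nonneg)
  ultimately show ?thesis unfolding b_def by blast
qed

end

section \<open>Switchings\<close>

text \<open>Exchange argument: pay for the head of the list with itself if it is in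
  \<open>A\<close>, otherwise with any element of \<open>A\<close>, which is no larger. Multisets
  take care of ties.\<close>

lemma sum_mset_le_take_sorted:
  fixes ys :: "nat list"
  assumes "A \<subseteq># mset ys" "sorted_wrt (\<ge>) ys" "size A \<le> k"
  shows "sum_mset A \<le> sum_list (take k ys)"
  using assms
proof (induction ys arbitrary: A k)
  case (Cons y ys)
  show ?case
  proof (cases "A = {#}")
    case False
    then obtain k' where k: "k = Suc k'" using Cons.prems(3) by (cases k) auto
    obtain x A' where A: "A = add_mset x A'" and x: "x \<le> y" and A': "A' \<subseteq># mset ys"
    proof (cases "y \<in># A")
      case True
      then obtain A' where "A = add_mset y A'" by (metis insert_DiffM)
      then show ?thesis using that[of y A'] Cons.prems(1) by simp
    next
      case False
      then have sub: "A \<subseteq># mset ys" using Cons.prems(1)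
        by (metis add_mset_remove_trivial diff_single_trivial mset.simps(2) subset_eq_diff_conv add_mset_add_single)
      obtain x where "x \<in># A" using \<open>A \<noteq> {#}\<close> by blast
      then obtain A' where A': "A = add_mset x A'" by (metis insert_DiffM)
      have "x \<in> set ys" using \<open>x \<in># A\<close> sub by (metis mset_subset_eqD set_mset_mset)
      then have "x \<le> y" using Cons.prems(2) by simp
      moreover have "A' \<subseteq># mset ys" using sub unfolding A' by (metis mset_subset_eq_insertD subset_mset.less_imp_le)
      ultimately show ?thesis using that A' by blast
    qed
    have "sum_mset A' \<le> sum_list (take k' ys)"
      using Cons.prems A' by (intro Cons.IH) (auto simp: A k)
    then show ?thesis using x by (simp add: A k)
  qed simp
qed simp

text \<open>Meant for neighbourhoods, whose size never exceeds the maximum degree.\<close>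

lemma sum_le_J:
  assumes "S \<subseteq> {1..n}" "card S \<le> max_deg n d"
  shows "sum d S \<le> J n d"
proof -
  have fin: "finite S" using assms(1) finite_subset by blast
  have "sum d S = sum_mset (image_mset d (mset_set S))"
    by (simp add: sum_unfold_sum_mset)
  also have "\<dots> \<le> J n d"
    unfolding J_def
  proof (rule sum_mset_le_take_sorted)
    have "mset_set S \<subseteq># mset_set {1..n}" using assms(1) by (simp add: subset_imp_msubset_mset_set)
    moreover have "mset (rev (sort (map d [1..<Suc n]))) = image_mset d (mset_set {1..n})"
      by (simp add: atLeastLessThanSuc_atLeastAtMost del: upt_Suc)
    ultimately show "image_mset d (mset_set S) \<subseteq># mset (rev (sort (map d [1..<Suc n])))"
      by (simp only: image_mset_subseteq_mono)
    show "sorted_wrt (\<ge>) (rev (sort (map d [1..<Suc n])))"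
      by (simp add: sorted_wrt_rev del: upt_Suc)
  qed (use assms fin in simp)
  finally show ?thesis .
qed

section \<open>Degrees and oriented edges\<close>

definition neighbours :: "graph \<Rightarrow> nat \<Rightarrow> nat set" where
  "neighbours F u = {v. {u, v} \<in> F}"

text \<open>Edges with an orientation: in the switching the two ends of the third edge play
  different roles, one being joined to \<open>a\<close> and the other to \<open>b\<close>.\<close>

definition darts :: "graph \<Rightarrow> (nat \<times> nat) set" where
  "darts F = {(u, v). {u, v} \<in> F}"

lemma simple_graph_edgeD:
  assumes "simple_graph n F" "{u, v} \<in> F"
  shows "u \<noteq> v" "u \<in> {1..n}" "v \<in> {1..n}"
  using assms by (auto simp: simple_graph_def card_insert_if split: if_splits)

lemma simple_graph_finite: "simple_graph n F \<Longrightarrow> finite F"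
  by (rule finite_subset[of _ "Pow {1..n}"]) (auto simp: simple_graph_def)

lemma simple_graph_subset: "simple_graph n F \<Longrightarrow> F' \<subseteq> F \<Longrightarrow> simple_graph n F'"
  by (auto simp: simple_graph_def)

lemma finite_neighbours: "simple_graph n F \<Longrightarrow> finite (neighbours F u)"
  by (rule finite_subset[of _ "{1..n}"]) (auto simp: neighbours_def dest: simple_graph_edgeD)

lemma card_neighbours:
  assumes "simple_graph n F"
  shows "card (neighbours F u) = degree F u"
proof -
  have "{e \<in> F. u \<in> e} = (\<lambda>v. {u, v}) ` neighbours F u"
  proof
    show "{e \<in> F. u \<in> e} \<subseteq> (\<lambda>v. {u, v}) ` neighbours F u"
    proof
      fix e assume e: "e \<in> {e \<in> F. u \<in> e}"
      then have "card e = 2" using assms by (auto simp: simple_graph_def)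
      then obtain v where "e = {u, v}" using e by (auto simp: card_2_iff)
      then show "e \<in> (\<lambda>v. {u, v}) ` neighbours F u" using e by (auto simp: neighbours_def)
    qed
  qed (auto simp: neighbours_def)
  moreover have "inj_on (\<lambda>v. {u, v}) (neighbours F u)" by (auto simp: inj_on_def doubleton_eq_iff)
  ultimately show ?thesis by (simp add: degree_def card_image)
qed

lemma card_darts_from:
  assumes "simple_graph n F" "finite S"
  shows "card {x \<in> darts F. fst x \<in> S} = (\<Sum>u\<in>S. degree F u)"
proof -
  have "{x \<in> darts F. fst x \<in> S} = Sigma S (neighbours F)"
    by (auto simp: darts_def neighbours_def)
  then show ?thesis using assms finite_neighbours by (simp add: card_neighbours[OF assms(1)])
qed

lemma card_darts_to:
  assumes "simple_graph n F" "finite S"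
  shows "card {x \<in> darts F. snd x \<in> S} = (\<Sum>u\<in>S. degree F u)"
proof -
  have "bij_betw prod.swap {x \<in> darts F. fst x \<in> S} {x \<in> darts F. snd x \<in> S}"
    by (rule bij_betwI[of _ _ _ prod.swap]) (auto simp: darts_def insert_commute)
  then show ?thesis using card_darts_from[OF assms] by (simp add: bij_betw_same_card)
qed

lemma handshake:
  assumes "simple_graph n F"
  shows "(\<Sum>v\<in>{1..n}. degree F v) = 2 * card F"
proof -
  have fin: "finite F" by (rule simple_graph_finite[OF assms])
  have "(\<Sum>v\<in>{1..n}. degree F v) = (\<Sum>v\<in>{1..n}. \<Sum>e\<in>F. of_bool (v \<in> e))"
    using fin by (simp add: degree_def sum_of_bool_eq Int_def)
  also have "\<dots> = (\<Sum>e\<in>F. \<Sum>v\<in>{1..n}. of_bool (v \<in> e))" by (rule sum.swap)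
  also have "\<dots> = (\<Sum>e\<in>F. 2)"
  proof (rule sum.cong)
    fix e assume "e \<in> F"
    then have "e \<subseteq> {1..n}" "card e = 2" using assms by (auto simp: simple_graph_def)
    then show "(\<Sum>v\<in>{1..n}. of_bool (v \<in> e)) = (2::nat)"
      by (simp add: sum_of_bool_eq Int_absorb1)
  qed simp
  finally show ?thesis by simp
qed

lemma card_darts:
  assumes "simple_graph n F"
  shows "card (darts F) = 2 * card F"
proof -
  have "darts F = {x \<in> darts F. fst x \<in> {1..n}}"
    using assms by (auto simp: darts_def dest: simple_graph_edgeD)
  then show ?thesis using card_darts_from[OF assms, of "{1..n}"] handshake[OF assms] by simp
qed

lemma finite_darts: "simple_graph n F \<Longrightarrow> finite (darts F)"
  by (rule finite_subset[of _ "{1..n} \<times> {1..n}"]) (auto simp: darts_def dest: simple_graph_edgeD)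

lemma degree_Diff:
  assumes "finite G" "H \<subseteq> G"
  shows "degree (G - H) v = degree G v - degree H v"
proof -
  have "{e \<in> G - H. v \<in> e} = {e \<in> G. v \<in> e} - {e \<in> H. v \<in> e}" by auto
  moreover have "finite H" using assms finite_subset by blast
  ultimately show ?thesis using assms by (simp add: degree_def card_Diff_subset Collect_mono_iff subset_iff)
qed

lemma degree_mono: "finite G \<Longrightarrow> H \<subseteq> G \<Longrightarrow> degree H v \<le> degree G v"
  by (auto simp: degree_def intro!: card_mono)

lemma degree_Un:
  assumes "finite F" "finite F'" "F \<inter> F' = {}"
  shows "degree (F \<union> F') v = degree F v + degree F' v"
proof -
  have "{e \<in> F \<union> F'. v \<in> e} = {e \<in> F. v \<in> e} \<union> {e \<in> F'. v \<in> e}" by auto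
  then show ?thesis using assms by (simp add: degree_def) (subst card_Un_disjoint, auto)
qed

lemma degree_three:
  assumes "e1 \<noteq> e2" "e1 \<noteq> e3" "e2 \<noteq> e3"
  shows "degree {e1, e2, e3} v = of_bool (v \<in> e1) + of_bool (v \<in> e2) + of_bool (v \<in> e3)"
proof -
  have "{e \<in> {e1, e2, e3}. v \<in> e} = {e1, e2, e3} \<inter> {e. v \<in> e}" by auto
  then have "degree {e1, e2, e3} v = (\<Sum>e\<in>{e1, e2, e3}. of_bool (v \<in> e))"
    unfolding degree_def by (subst sum_of_bool_eq) auto
  then show ?thesis using assms by simp
qed

lemma switch_in_graphs:
  assumes G: "G \<in> graphs_with_degrees n d"
    and old: "{j, a} \<in> G" "{k, b} \<in> G" "{c, w} \<in> G"
    and new: "{j, k} \<notin> G" "{a, c} \<notin> G" "{b, w} \<notin> G"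
    and ne: "j \<noteq> k" "a \<noteq> c" "b \<noteq> w"
  shows "G - {{j, a}, {k, b}, {c, w}} \<union> {{j, k}, {a, c}, {b, w}} \<in> graphs_with_degrees n d"
proof -
  let ?R = "{{j, a}, {k, b}, {c, w}}" and ?A = "{{j, k}, {a, c}, {b, w}}"
  have simp: "simple_graph n G" and deg: "\<And>v. v \<in> {1..n} \<Longrightarrow> degree G v = d v"
    using G by (auto simp: graphs_with_degrees_def)
  note E = simple_graph_edgeD[OF simp]
  have range: "j \<in> {1..n}" "k \<in> {1..n}" "a \<in> {1..n}" "b \<in> {1..n}" "c \<in> {1..n}" "w \<in> {1..n}"
    and ne': "j \<noteq> a" "k \<noteq> b" "c \<noteq> w"
    using E[OF old(1)] E[OF old(2)] E[OF old(3)] by blast+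
  \<comment> \<open>Each of these coincidences would make an edge of \<open>G\<close> equal to a
    non-edge. Others, such as \<open>a = b\<close>, are allowed, so degrees are compared by
    indicator sums in which each of the six letters occurs once on either side.\<close>
  have ne'': "a \<noteq> k" "b \<noteq> j" "c \<noteq> j" "w \<noteq> k" "\<not> (a = w \<and> c = b)"
    using old new by (auto simp: insert_commute)
  have R: "{j, a} \<noteq> {k, b}" "{j, a} \<noteq> {c, w}" "{k, b} \<noteq> {c, w}"
    using ne ne' ne'' by (auto simp: doubleton_eq_iff)
  have A: "{j, k} \<noteq> {a, c}" "{j, k} \<noteq> {b, w}" "{a, c} \<noteq> {b, w}"
    using ne ne' ne'' by (auto simp: doubleton_eq_iff)
  have "degree ?R v = degree ?A v" for v
  proof -
    have "of_bool (v \<in> {x, y}) = of_bool (v = x) + (of_bool (v = y) :: nat)" if "x \<noteq> y" for x y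
      using that by auto
    then show ?thesis
      unfolding degree_three[OF R] degree_three[OF A] using ne ne' by simp
  qed
  moreover have "degree ?R v \<le> degree G v" for v
    using old simple_graph_finite[OF simp] by (intro degree_mono) auto
  moreover have "degree (G - ?R \<union> ?A) v = degree G v - degree ?R v + degree ?A v" for v
  proof -
    have "degree (G - ?R \<union> ?A) v = degree (G - ?R) v + degree ?A v"
      by (rule degree_Un) (use new simple_graph_finite[OF simp] in blast)+
    also have "degree (G - ?R) v = degree G v - degree ?R v"
      by (rule degree_Diff[OF simple_graph_finite[OF simp]]) (use old in blast)
    finally show ?thesis .
  qed
  ultimately have "degree (G - ?R \<union> ?A) v = degree G v" for v by simp
  moreover have "simple_graph n (G - ?R \<union> ?A)"
    using simp range ne by (auto simp: simple_graph_def)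
  ultimately show ?thesis using deg by (simp add: graphs_with_degrees_def)
qed

text \<open>The auxiliary third edge \<open>c w\<close> is what makes the switching work for every degree sequence with
  small \<open>J\<close>: replacing \<open>j a\<close>, \<open>k b\<close> by \<open>j k\<close>, \<open>a b\<close> would require few edges between the
  neighbourhoods of \<open>j\<close> and \<open>k\<close>, whereas at most \<open>4 J\<close> of the choices of \<open>(c, w)\<close> are forbidden.\<close>

lemma switching:
  assumes m: "\<And>G. G \<in> graphs_with_degrees n d \<Longrightarrow> card G = m"
    and jk: "j \<in> {1..n}" "k \<in> {1..n}" "j \<noteq> k" "{j, k} \<notin> H"
  shows "card {G \<in> extensions (graphs_with_degrees n d) H. {j, k} \<notin> G} *
      ((d j - degree H j) * (d k - degree H k) * (2 * (m - card H) - 4 * J n d))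
    \<le> card (extensions (graphs_with_degrees n d) (insert {j, k} H)) * (2 * (m - card H))\<^sup>2"
proof -
  define \<Omega> where "\<Omega> = graphs_with_degrees n d"
  define A where "A = extensions \<Omega> (insert {j, k} H)"
  define B where "B = {G \<in> extensions \<Omega> H. {j, k} \<notin> G}"
  define M where "M = 2 * (m - card H)"
  define D where "D G a b = {x \<in> darts (G - H). fst x \<notin> insert a (neighbours G a) \<and> snd x \<notin> insert b (neighbours G b)}" for G a b
  define T where "T G = Sigma (neighbours (G - H) j \<times> neighbours (G - H) k) (\<lambda>(a, b). D G a b)" for G
  have Om: "finite \<Omega>" unfolding \<Omega>_def
    by (rule finite_subset[of _ "Pow (Pow {1..n})"]) (auto simp: graphs_with_degrees_def simple_graph_def)
  have simp: "simple_graph n G" "simple_graph n (G - H)" "finite G" and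
    deg: "degree G v = d v" if "G \<in> \<Omega>" "v \<in> {1..n}" for G v
    using that simple_graph_subset[of n G "G - H"] simple_graph_finite[of n G]
    by (auto simp: \<Omega>_def graphs_with_degrees_def)
  have simp: "simple_graph n G" "simple_graph n (G - H)" "finite G" if "G \<in> \<Omega>" for G
    using simp[OF that jk(1)] by blast+
  have cd: "card (darts (G - H)) = M" if "G \<in> \<Omega>" "H \<subseteq> G" for G
    using card_darts[OF simp(2)[OF that(1)]] m that simp(3)[OF that(1)] finite_subset[OF that(2)]
    by (simp add: M_def \<Omega>_def card_Diff_subset)
  \<comment> \<open>One \<open>J\<close> for the neighbours and one for \<open>a\<close> itself.
    With maximum degree zero \<open>J\<close> is an empty sum, but then
    \<open>d a = 0\<close>.\<close>
  have nbJ: "(\<Sum>u\<in>insert a (neighbours G a). degree G u) \<le> 2 * J n d" if G: "G \<in> \<Omega>" and a: "a \<in> {1..n}" for G a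
  proof -
    have sub: "neighbours G a \<subseteq> {1..n}" using simple_graph_edgeD[OF simp(1)[OF G]] by (auto simp: neighbours_def)
    have le: "d a \<le> max_deg n d" using a by (auto simp: max_deg_def)
    have "d a \<le> J n d"
    proof (cases "max_deg n d = 0")
      case False
      then show ?thesis using sum_le_J[of "{a}" n d] a by simp
    qed (use le in simp)
    moreover have "sum d (neighbours G a) \<le> J n d"
      using le card_neighbours[OF simp(1)[OF G], of a] deg[OF G a] sub by (intro sum_le_J) auto
    moreover have "(\<Sum>u\<in>insert a (neighbours G a). degree G u) = (\<Sum>u\<in>insert a (neighbours G a). d u)"
      using sub a by (intro sum.cong deg[OF G]) auto
    moreover have "\<dots> \<le> d a + sum d (neighbours G a)"
      using finite_neighbours[OF simp(1)[OF G]] by (simp add: sum.insert_if)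
    ultimately show ?thesis by linarith
  qed
  have cD: "card (D G a b) \<ge> M - 4 * J n d" if G: "G \<in> \<Omega>" "H \<subseteq> G" and a: "a \<in> {1..n}" and b: "b \<in> {1..n}" for G a b
  proof -
    let ?X = "{x \<in> darts G. fst x \<in> insert a (neighbours G a)}"
    let ?Y = "{x \<in> darts G. snd x \<in> insert b (neighbours G b)}"
    note s = simp(1)[OF G(1)]
    have "card ?X \<le> 2 * J n d"
      using nbJ[OF G(1) a] finite_neighbours[OF s] by (subst card_darts_from[OF s]) auto
    moreover have "card ?Y \<le> 2 * J n d"
      using nbJ[OF G(1) b] finite_neighbours[OF s] by (subst card_darts_to[OF s]) auto
    moreover have "darts (G - H) \<subseteq> D G a b \<union> (?X \<union> ?Y)"
      by (auto simp: D_def darts_def)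
    then have "card (darts (G - H)) \<le> card (D G a b \<union> (?X \<union> ?Y))"
      using finite_darts[OF s] finite_darts[OF simp(2)[OF G(1)]] by (intro card_mono) (auto simp: D_def)
    moreover have "card (D G a b \<union> (?X \<union> ?Y)) \<le> card (D G a b) + (card ?X + card ?Y)"
      by (meson card_Un_le add_left_mono order_trans)
    ultimately show ?thesis using cd[OF G] by linarith
  qed
  have finT: "finite (T G)" and cT: "card (T G) \<ge> (d j - degree H j) * (d k - degree H k) * (M - 4 * J n d)" if "G \<in> B" for G
  proof -
    have G: "G \<in> \<Omega>" "H \<subseteq> G" using that by (auto simp: B_def extensions_def)
    have nbc: "card (neighbours (G - H) v) = d v - degree H v" if "v \<in> {1..n}" for v
      using card_neighbours[OF simp(2)[OF G(1)]] degree_Diff[OF simp(3)[OF G(1)] G(2)] deg[OF G(1) that] by simp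
    have finD: "finite (D G a b)" for a b
      using finite_darts[OF simp(2)[OF G(1)]] by (simp add: D_def)
    have fin: "finite (neighbours (G - H) j \<times> neighbours (G - H) k)"
      using finite_neighbours[OF simp(2)[OF G(1)]] by blast
    have sub: "neighbours (G - H) v \<subseteq> {1..n}" for v
      using simple_graph_edgeD[OF simp(2)[OF G(1)]] by (auto simp: neighbours_def)
    show "finite (T G)" unfolding T_def using fin finD by auto
    have "card (T G) = (\<Sum>(a, b)\<in>neighbours (G - H) j \<times> neighbours (G - H) k. card (D G a b))"
      unfolding T_def using fin finD by (subst card_SigmaI) (auto simp: case_prod_beta)
    also have "\<dots> \<ge> (\<Sum>(a, b)\<in>neighbours (G - H) j \<times> neighbours (G - H) k. M - 4 * J n d)"
    proof (rule sum_mono)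
      fix x assume "x \<in> neighbours (G - H) j \<times> neighbours (G - H) k"
      then have "fst x \<in> {1..n}" "snd x \<in> {1..n}" using sub by (fastforce simp: mem_Times_iff)+
      then show "(case x of (a, b) \<Rightarrow> M - 4 * J n d) \<le> (case x of (a, b) \<Rightarrow> card (D G a b))"
        using cD[OF G] by (simp add: case_prod_beta)
    qed
    also have "(\<Sum>(a, b)\<in>neighbours (G - H) j \<times> neighbours (G - H) k. M - 4 * J n d)
      = (d j - degree H j) * (d k - degree H k) * (M - 4 * J n d)"
      by (simp add: card_cartesian_product nbc[OF jk(1)] nbc[OF jk(2)])
    finally show "card (T G) \<ge> (d j - degree H j) * (d k - degree H k) * (M - 4 * J n d)" .
  qed
  have finB: "finite B" "finite A" using Om by (auto simp: B_def A_def extensions_def)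
  \<comment> \<open>Recording the oriented new edges makes the switching reversible: they name
    \<open>a\<close>, \<open>b\<close>, \<open>c\<close>, \<open>w\<close>, and the old graph can be
    rebuilt. Both avoid \<open>H\<close>, so each target graph has at most \<open>M\<^sup>2\<close>
    preimages.\<close>
  define \<phi> where "\<phi> = (\<lambda>(G :: graph, (a, b), (c, w)).
    (G - {{j, a}, {k, b}, {c, w}} \<union> {{j, k}, {a, c}, {b, w}}, (a, c), (b, w)))"
  have valid: "{j, a} \<in> G" "{k, b} \<in> G" "{c, w} \<in> G" "{j, a} \<notin> H" "{k, b} \<notin> H" "{c, w} \<notin> H"
      "{j, k} \<notin> G" "{a, c} \<notin> G" "{b, w} \<notin> G" "a \<noteq> c" "b \<noteq> w" "G \<in> \<Omega>" "H \<subseteq> G"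
    if "(G, (a, b), (c, w)) \<in> Sigma B T" for G a b c w
    using that by (auto simp: B_def T_def D_def darts_def neighbours_def extensions_def)
  have "card (Sigma B T) \<le> card (Sigma A (\<lambda>G. darts (G - H) \<times> darts (G - H)))"
  proof (rule card_inj_on_le[of \<phi>])
    show "inj_on \<phi> (Sigma B T)"
    proof (rule inj_onI)
      fix x y assume x: "x \<in> Sigma B T" and y: "y \<in> Sigma B T" and eq: "\<phi> x = \<phi> y"
      obtain G a b c w where x': "x = (G, (a, b), (c, w))" by (metis prod.exhaust)
      obtain G' a' b' c' w' where y': "y = (G', (a', b'), (c', w'))" by (metis prod.exhaust)
      let ?R = "{{j, a}, {k, b}, {c, w}}" and ?A = "{{j, k}, {a, c}, {b, w}}"
      from eq have same: "a' = a" "b' = b" "c' = c" "w' = w" and GG: "G - ?R \<union> ?A = G' - ?R \<union> ?A"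
        by (auto simp: \<phi>_def x' y')
      note vx = valid[OF x[unfolded x']] and vy = valid[OF y[unfolded y' same]]
      have "?R \<subseteq> G" "?R \<subseteq> G'" "?A \<inter> G = {}" "?A \<inter> G' = {}" using vx vy by auto
      then have "G = (G - ?R \<union> ?A) - ?A \<union> ?R" "G' = (G' - ?R \<union> ?A) - ?A \<union> ?R"
        by blast+
      with GG have "G = G'" by (simp only:)
      then show "x = y" by (simp add: x' y' same)
    qed
    show "\<phi> ` Sigma B T \<subseteq> Sigma A (\<lambda>G. darts (G - H) \<times> darts (G - H))"
    proof
      fix y assume "y \<in> \<phi> ` Sigma B T"
      then obtain G a b c w where x: "(G, (a, b), (c, w)) \<in> Sigma B T" and y: "y = \<phi> (G, (a, b), (c, w))" by auto
      note v = valid[OF x]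
      have "G - {{j, a}, {k, b}, {c, w}} \<union> {{j, k}, {a, c}, {b, w}} \<in> \<Omega>"
        unfolding \<Omega>_def using v jk by (intro switch_in_graphs) (auto simp: \<Omega>_def)
      then show "y \<in> Sigma A (\<lambda>G. darts (G - H) \<times> darts (G - H))"
        using v jk by (auto simp: y \<phi>_def A_def extensions_def darts_def)
    qed
    show "finite (Sigma A (\<lambda>G. darts (G - H) \<times> darts (G - H)))"
      using finB finite_darts[OF simp(2)] by (auto simp: A_def extensions_def)
  qed
  also have "\<dots> = card A * M\<^sup>2"
  proof -
    have "card (Sigma A (\<lambda>G. darts (G - H) \<times> darts (G - H))) = (\<Sum>G\<in>A. card (darts (G - H) \<times> darts (G - H)))"
      using finB finite_darts[OF simp(2)] by (intro card_SigmaI) (auto simp: A_def extensions_def)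
    also have "\<dots> = (\<Sum>G\<in>A. M\<^sup>2)"
      by (intro sum.cong) (auto simp: A_def extensions_def card_cartesian_product cd power2_eq_square)
    finally show ?thesis by simp
  qed
  finally have "card (Sigma B T) \<le> card A * M\<^sup>2" .
  moreover have "card (Sigma B T) = (\<Sum>G\<in>B. card (T G))"
    using finB finT by (intro card_SigmaI) auto
  moreover have "(\<Sum>G\<in>B. card (T G)) \<ge> (\<Sum>G\<in>B. (d j - degree H j) * (d k - degree H k) * (M - 4 * J n d))"
    by (intro sum_mono cT)
  ultimately show ?thesis by (simp add: A_def B_def M_def \<Omega>_def)
qed

section \<open>Concentration of the revealed degrees\<close>

text \<open>The ratio of consecutive binomial weights shows that they rise up to \<open>k\<close>
  and fall afterwards. The largest of m + 1 weights with sum one is at least 1 / (m + 1).\<close>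

lemma binomial_mode:
  fixes k m :: nat
  assumes "k < m"
  defines "p \<equiv> real k / real m"
  shows "1 \<le> real (m + 1) * (real (m choose k) * p ^ k * (1 - p) ^ (m - k))"
proof -
  define a where "a j = real (m choose j) * p ^ j * (1 - p) ^ (m - j)" for j
  have p: "0 \<le> p" "p < 1" using assms by (auto simp: p_def)
  have q: "1 - p = real (m - k) / real m" using assms by (simp add: p_def of_nat_diff field_simps)
  have a0: "a j \<ge> 0" for j using p by (simp add: a_def)
  have rec: "a (Suc j) * (real (Suc j) * (1 - p)) = a j * (real (m - j) * p)" if "j < m" for j
  proof -
    have "Suc j * (m choose Suc j) = (m - j) * (m choose j)"
      using that binomial_absorb_comp[of m j] binomial_absorption[of j m] by simp
    then have 1: "real (Suc j) * real (m choose Suc j) = real (m - j) * real (m choose j)"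
      by (metis of_nat_mult)
    have 2: "(1 - p) ^ (m - j) = (1 - p) * (1 - p) ^ (m - Suc j)"
      using that by (metis Suc_diff_Suc power_Suc)
    have "a (Suc j) * (real (Suc j) * (1 - p)) =
        (real (Suc j) * real (m choose Suc j)) * p ^ Suc j * ((1 - p) * (1 - p) ^ (m - Suc j))"
      by (simp add: a_def)
    also have "\<dots> = a j * (real (m - j) * p)"
      unfolding 1 2[symmetric] by (simp add: a_def)
    finally show ?thesis .
  qed
  have up: "a j \<le> a (Suc j)" if "j < k" for j
  proof -
    have "real (Suc j) * real (m - k) \<le> real (m - j) * real k"
    proof -
      have "real (Suc j) * real m \<le> real k * real m" using that by (intro mult_right_mono) auto
      then show ?thesis using that assms by (simp add: of_nat_diff algebra_simps)
    qed
    then have "real (Suc j) * (1 - p) \<le> real (m - j) * p"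
      unfolding q unfolding p_def times_divide_eq_right by (rule divide_right_mono) simp
    then have "a j * (real (m - j) * p) \<le> a (Suc j) * (real (m - j) * p)"
      using rec[of j] that assms mult_left_mono[OF _ a0[of "Suc j"]] by (metis less_trans)
    moreover have "real (m - j) * p > 0" using that assms by (simp add: p_def)
    ultimately show ?thesis by (rule mult_right_le_imp_le)
  qed
  have down: "a (Suc j) \<le> a j" if "k \<le> j" "j < m" for j
  proof -
    have "real (m - j) * real k \<le> real (Suc j) * real (m - k)"
    proof -
      have "real k * real m \<le> real j * real m" using that by (intro mult_right_mono) auto
      moreover have "real k \<le> real m" using that by simp
      moreover have diff: "real (m - j) = real m - real j" "real (m - k) = real m - real k"
        using that by (simp_all add: of_nat_diff)
      ultimately show ?thesis unfolding diff of_nat_Suc by (simp only: algebra_simps mult_1_left)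
    qed
    then have "real (m - j) * p \<le> real (Suc j) * (1 - p)"
      unfolding q unfolding p_def times_divide_eq_right by (rule divide_right_mono) simp
    then have "a (Suc j) * (real (Suc j) * (1 - p)) \<le> a j * (real (Suc j) * (1 - p))"
      using rec[OF that(2)] mult_left_mono[OF _ a0[of j]] by metis
    moreover have "real (Suc j) * (1 - p) > 0" using p by simp
    ultimately show ?thesis by (rule mult_right_le_imp_le)
  qed
  have le: "a j \<le> a k" if "j \<le> m" for j
  proof (cases "j \<le> k")
    case True
    then show ?thesis
      by (induction rule: inc_induct) (use up in force)+
  next
    case False
    then have "k \<le> j" by simp
    then show ?thesis using that
      by (induction rule: dec_induct) (use down in force)+
  qed
  have "1 = (p + (1 - p)) ^ m" by simp
  also have "\<dots> = (\<Sum>j\<le>m. a j)" by (simp only: binomial_ring a_def)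
  also have "\<dots> \<le> (\<Sum>j\<le>m. a k)" by (intro sum_mono le) auto
  finally show ?thesis by (simp add: a_def)
qed

text \<open>A uniform \<open>k\<close>-subset is a binomial random subset conditioned on its most likely size, so
  Hoeffding's inequality carries over at the price of a factor \<open>m + 1\<close>.\<close>

lemma card_subsets_large_intersection_le:
  assumes "finite G" "card G = m" "A \<subseteq> G" "k < m" "\<eta> \<ge> 0"
  shows "real (card {H. H \<subseteq> G \<and> card H = k \<and> (real k / real m + \<eta>) * real (card A) \<le> real (card (H \<inter> A))})
    \<le> real (m + 1) * exp (- 2 * \<eta>\<^sup>2 * real (card A)) * real (m choose k)"
proof -
  define p where "p = real k / real m"
  define P where "P = Pi_pmf G False (\<lambda>_. bernoulli_pmf p)"
  define \<H> where "\<H> = {H. H \<subseteq> G \<and> card H = k \<and> (p + \<eta>) * real (card A) \<le> real (card (H \<inter> A))}"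
  have p: "0 \<le> p" "p \<le> 1" using assms by (auto simp: p_def)
  have finA: "finite A" using assms finite_subset by blast
  have fin: "finite \<H>" using assms(1) by (auto simp: \<H>_def)
  \<comment> \<open>All \<open>k\<close>-subsets have the same weight under the product measure, so
    counting them amounts to dividing a probability by this weight.\<close>
  have pmfP: "pmf P (\<lambda>x. x \<in> H) = p ^ k * (1 - p) ^ (m - k)" if "H \<subseteq> G" "card H = k" for H
  proof -
    have "pmf P (\<lambda>x. x \<in> H) = (\<Prod>x\<in>G. if x \<in> H then p else 1 - p)"
      unfolding P_def using that assms(1) p
      by (subst pmf_Pi') (auto intro!: prod.cong)
    also have "\<dots> = p ^ card H * (1 - p) ^ card (G - H)"
      using that assms(1) by (subst prod.If_cases) (auto simp: Int_absorb1 set_diff_eq[symmetric] Diff_eq)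
    finally show ?thesis using that assms by (simp add: card_Diff_subset finite_subset)
  qed
  have binom: "map_pmf (\<lambda>f. card {x \<in> A. f x}) P = binomial_pmf (card A) p"
  proof -
    have "binomial_pmf (card A) p = map_pmf (\<lambda>f. card {x \<in> A. f x}) (Pi_pmf A False (\<lambda>_. bernoulli_pmf p))"
      using finA p by (intro binomial_pmf_altdef') auto
    also have "\<dots> = map_pmf (\<lambda>f. card {x \<in> A. f x}) (map_pmf (\<lambda>f x. if x \<in> A then f x else False) P)"
      unfolding P_def using assms by (subst Pi_pmf_subset[of G A]) auto
    also have "\<dots> = map_pmf (\<lambda>f. card {x \<in> A. f x}) P"
      by (simp add: pmf.map_comp o_def cong: conj_cong)
    finally show ?thesis ..
  qed
  have tail: "measure_pmf.prob (binomial_pmf (card A) p) {x. (p + \<eta>) * real (card A) \<le> real x}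
      \<le> exp (- 2 * \<eta>\<^sup>2 * real (card A))"
  proof (cases "card A = 0")
    case False
    interpret binomial_distribution "card A" p by unfold_locales (use p in auto)
    have "measure_pmf.prob (binomial_pmf (card A) p) {x. real (card A) * p + \<eta> * real (card A) \<le> real x}
        \<le> exp (- 2 * (\<eta> * real (card A))\<^sup>2 / real (card A))"
      using False assms by (intro prob_ge) auto
    also have "- 2 * (\<eta> * real (card A))\<^sup>2 / real (card A) = - 2 * \<eta>\<^sup>2 * real (card A)"
      using False by (simp add: power2_eq_square)
    finally show ?thesis by (simp add: algebra_simps)
  qed simp
  have "real (card \<H>) * (p ^ k * (1 - p) ^ (m - k)) = (\<Sum>H\<in>\<H>. pmf P (\<lambda>x. x \<in> H))"
    using pmfP by (simp add: \<H>_def)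
  also have "\<dots> = measure_pmf.prob P ((\<lambda>H x. x \<in> H) ` \<H>)"
    using fin by (subst measure_measure_pmf_finite) (auto simp: sum.reindex inj_on_def fun_eq_iff set_eq_iff)
  also have "\<dots> \<le> measure_pmf.prob P ((\<lambda>f. card {x \<in> A. f x}) -` {x. (p + \<eta>) * real (card A) \<le> real x})"
  proof (intro measure_pmf.finite_measure_mono)
    have "{x \<in> A. x \<in> H} = H \<inter> A" for H by auto
    then show "(\<lambda>H x. x \<in> H) ` \<H> \<subseteq> (\<lambda>f. card {x \<in> A. f x}) -` {x. (p + \<eta>) * real (card A) \<le> real x}"
      by (auto simp: \<H>_def)
  qed simp
  also have "\<dots> = measure_pmf.prob (binomial_pmf (card A) p) {x. (p + \<eta>) * real (card A) \<le> real x}"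
    unfolding binom[symmetric] by simp
  also note tail
  finally have le: "real (card \<H>) * (p ^ k * (1 - p) ^ (m - k)) \<le> exp (- 2 * \<eta>\<^sup>2 * real (card A))" .
  have "real (card \<H>) * 1 \<le> real (card \<H>) * (real (m + 1) * (real (m choose k) * p ^ k * (1 - p) ^ (m - k)))"
    using binomial_mode[OF assms(4)] by (intro mult_left_mono) (auto simp: p_def)
  also have "\<dots> = real (m + 1) * real (m choose k) * (real (card \<H>) * (p ^ k * (1 - p) ^ (m - k)))"
    by (simp only: mult_ac)
  also have "\<dots> \<le> real (m + 1) * real (m choose k) * exp (- 2 * \<eta>\<^sup>2 * real (card A))"
    using le by (intro mult_left_mono) auto
  finally show ?thesis by (simp add: \<H>_def p_def mult_ac)
qed

text \<open>Count marked pairs fibre by fibre over \<open>G\<close>: as every \<open>G\<close> meets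
  \<open>A\<close> in exactly \<open>a\<close> elements, the same tail bound holds in each fibre. In
  use, \<open>A\<close> is the star of a vertex and \<open>a\<close> its degree.\<close>

lemma prob_revealed_large_intersection_le:
  assumes fin: "finite E" and sub: "\<Omega> \<subseteq> Pow E" and ne: "\<Omega> \<noteq> {}"
    and card: "\<And>G. G \<in> \<Omega> \<Longrightarrow> card G = m"
    and A: "\<And>G. G \<in> \<Omega> \<Longrightarrow> card (G \<inter> A) = a"
    and k: "k < m" and "\<eta> \<ge> 0"
  shows "measure_pmf.prob (revealed \<Omega> k) {H. (real k / real m + \<eta>) * real a \<le> real (card (H \<inter> A))}
    \<le> real (m + 1) * exp (- 2 * \<eta>\<^sup>2 * real a)"
proof -
  note ctx = fin sub ne card
  have finO: "finite \<Omega>" using fin sub finite_subset by blast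
  have finG: "finite G" if "G \<in> \<Omega>" for G using that fin sub finite_subset by blast
  define S where "S G = {H. H \<subseteq> G \<and> card H = k \<and> (real k / real m + \<eta>) * real a \<le> real (card (H \<inter> A))}" for G
  have finS: "finite (S G)" if "G \<in> \<Omega>" for G using finG[OF that] by (simp add: S_def)
  have S: "real (card (S G)) \<le> real (m + 1) * exp (- 2 * \<eta>\<^sup>2 * real a) * real (m choose k)" if "G \<in> \<Omega>" for G
  proof -
    have "S G = {H. H \<subseteq> G \<and> card H = k \<and> (real k / real m + \<eta>) * real (card (G \<inter> A)) \<le> real (card (H \<inter> (G \<inter> A)))}"
      using A[OF that] by (auto simp: S_def Int_absorb2 simp flip: Int_assoc)
    then show ?thesis
      using card_subsets_large_intersection_le[OF finG[OF that] card[OF that] _ k \<open>\<eta> \<ge> 0\<close>, of "G \<inter> A"] A[OF that] by simp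
  qed
  have "card (marked \<Omega> k) = card (Sigma \<Omega> (\<lambda>G. {H. H \<subseteq> G \<and> card H = k}))"
    by (rule bij_betw_same_card[of prod.swap], rule bij_betwI[of _ _ _ prod.swap]) (auto simp: marked_def)
  also have "\<dots> = (\<Sum>G\<in>\<Omega>. card {H. H \<subseteq> G \<and> card H = k})"
    using finO finG by (intro card_SigmaI) auto
  also have "\<dots> = card \<Omega> * (m choose k)"
    using n_subsets[OF finG] card by simp
  finally have cm: "card (marked \<Omega> k) = card \<Omega> * (m choose k)" .
  have pos: "real (card \<Omega> * (m choose k)) > 0"
    using ne finO k by (simp add: card_gt_0_iff zero_less_binomial_iff)
  have "card (marked \<Omega> k \<inter> fst -` {H. (real k / real m + \<eta>) * real a \<le> real (card (H \<inter> A))}) = card (Sigma \<Omega> S)"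
    by (rule bij_betw_same_card[of prod.swap], rule bij_betwI[of _ _ _ prod.swap]) (auto simp: marked_def S_def)
  also have "\<dots> = (\<Sum>G\<in>\<Omega>. card (S G))"
    using finO finS by (intro card_SigmaI) auto
  finally have cb: "real (card (marked \<Omega> k \<inter> fst -` {H. (real k / real m + \<eta>) * real a \<le> real (card (H \<inter> A))}))
      = (\<Sum>G\<in>\<Omega>. real (card (S G)))" by simp
  have "measure_pmf.prob (revealed \<Omega> k) {H. (real k / real m + \<eta>) * real a \<le> real (card (H \<inter> A))}
      = (\<Sum>G\<in>\<Omega>. real (card (S G))) / real (card \<Omega> * (m choose k))"
    unfolding revealed_def cb[symmetric] cm[symmetric] measure_map_pmf
    using k by (intro measure_pmf_of_set marked_nonempty[OF ctx] finite_marked[OF ctx]) auto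
  also have "\<dots> \<le> (\<Sum>G\<in>\<Omega>. real (m + 1) * exp (- 2 * \<eta>\<^sup>2 * real a) * real (m choose k)) / real (card \<Omega> * (m choose k))"
    using pos by (intro divide_right_mono sum_mono S) auto
  also have "\<dots> = real (m + 1) * exp (- 2 * \<eta>\<^sup>2 * real a)"
    using ne finO k unfolding sum_constant of_nat_mult by (simp add: mult.assoc card_gt_0_iff)
  finally show ?thesis .
qed

section \<open>Coupling for fixed order\<close>

definition edges_on :: "nat \<Rightarrow> nat set set" where
  "edges_on n = {e. e \<subseteq> {1..n} \<and> card e = 2}"

lemma finite_edges_on: "finite (edges_on n)"
  by (rule finite_subset[of _ "Pow {1..n}"]) (auto simp: edges_on_def)

lemma finite_vertex_pairs: "finite (vertex_pairs n)"
  by (rule finite_subset[of _ "{1..n} \<times> {1..n}"]) (auto simp: vertex_pairs_def)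

lemma bij_betw_vertex_pairs: "bij_betw (\<lambda>(j, k). {j, k}) (vertex_pairs n) (edges_on n)"
proof (rule bij_betw_imageI)
  show "inj_on (\<lambda>(j, k). {j, k}) (vertex_pairs n)"
    by (auto simp: inj_on_def vertex_pairs_def doubleton_eq_iff)
  show "(\<lambda>(j, k). {j, k}) ` vertex_pairs n = edges_on n"
  proof
    show "edges_on n \<subseteq> (\<lambda>(j, k). {j, k}) ` vertex_pairs n"
    proof
      fix e assume e: "e \<in> edges_on n"
      then obtain j k where jk: "e = {j, k}" "j \<noteq> k" by (auto simp: edges_on_def card_2_iff)
      show "e \<in> (\<lambda>(j, k). {j, k}) ` vertex_pairs n"
      proof (cases "j < k")
        case True
        then show ?thesis using e jk by (intro image_eqI[of _ _ "(j, k)"]) (auto simp: edges_on_def vertex_pairs_def)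
      next
        case False
        then show ?thesis using e jk by (intro image_eqI[of _ _ "(k, j)"]) (auto simp: edges_on_def vertex_pairs_def)
      qed
    qed
  qed (auto simp: vertex_pairs_def edges_on_def)
qed

text \<open>The graph lies inside \<open>S\<close> exactly if every pair outside \<open>S\<close> is
  absent, each independently with probability \<open>exp (- w e)\<close>. The result has the shape
  of the avoidance formula for Poisson draws.\<close>

lemma prob_indep_graph_Pow:
  assumes "\<And>j k. (j, k) \<in> vertex_pairs n \<Longrightarrow> W j k = 1 - exp (- w {j, k})"
    and "\<And>e. e \<in> edges_on n \<Longrightarrow> 0 \<le> w e"
  shows "measure_pmf.prob (indep_graph n W) (Pow S) = exp (- sum w (edges_on n - S))"
proof -
  let ?V = "vertex_pairs n"
  have "measure_pmf.prob (indep_graph n W) (Pow S)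
      = measure_pmf.prob (Pi_pmf ?V False (\<lambda>(j, k). bernoulli_pmf (W j k)))
          (Pi ?V (\<lambda>(j, k). if {j, k} \<in> S then UNIV else {False}))"
    unfolding indep_graph_def measure_map_pmf
  proof (rule arg_cong[where f = "measure_pmf.prob _"], rule set_eqI)
    fix x
    have "{{j, k} |j k. (j, k) \<in> ?V \<and> x (j, k)} \<subseteq> S \<longleftrightarrow> (\<forall>j k. (j, k) \<in> ?V \<longrightarrow> x (j, k) \<longrightarrow> {j, k} \<in> S)"
      by blast
    then show "x \<in> (\<lambda>x. {{j, k} |j k. (j, k) \<in> ?V \<and> x (j, k)}) -` Pow S \<longleftrightarrow>
        x \<in> Pi ?V (\<lambda>(j, k). if {j, k} \<in> S then UNIV else {False})"
      by (auto simp: Pi_iff)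
  qed
  also have "\<dots> = (\<Prod>x\<in>?V. measure_pmf.prob ((\<lambda>(j, k). bernoulli_pmf (W j k)) x)
      ((\<lambda>(j, k). if {j, k} \<in> S then UNIV else {False}) x))"
    by (rule measure_Pi_pmf_Pi[OF finite_vertex_pairs])
  also have "\<dots> = (\<Prod>x\<in>?V. exp (- (if (\<lambda>(j, k). {j, k}) x \<in> S then 0 else w ((\<lambda>(j, k). {j, k}) x))))"
  proof (rule prod.cong)
    fix x assume x: "x \<in> ?V"
    obtain j k where jk: "x = (j, k)" by (cases x)
    have "{j, k} \<in> edges_on n" using x bij_betw_vertex_pairs by (auto simp: jk bij_betw_def)
    then have "0 \<le> w {j, k}" by (rule assms(2))
    then show "measure_pmf.prob ((\<lambda>(j, k). bernoulli_pmf (W j k)) x)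
      ((\<lambda>(j, k). if {j, k} \<in> S then UNIV else {False}) x) =
      exp (- (if (\<lambda>(j, k). {j, k}) x \<in> S then 0 else w ((\<lambda>(j, k). {j, k}) x)))"
      using assms(1)[of j k] x by (simp add: jk measure_pmf_single)
  qed simp
  also have "\<dots> = (\<Prod>e\<in>edges_on n. exp (- (if e \<in> S then 0 else w e)))"
    by (rule prod.reindex_bij_betw[OF bij_betw_vertex_pairs])
  also have "\<dots> = exp (- (\<Sum>e\<in>edges_on n. if e \<in> S then 0 else w e))"
    by (simp add: exp_sum finite_edges_on sum_negf[symmetric])
  also have "(\<Sum>e\<in>edges_on n. if e \<in> S then 0 else w e) = sum w (edges_on n - S)"
    by (intro sum.mono_neutral_cong_right) (auto simp: finite_edges_on)
  finally show ?thesis .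
qed

lemma set_indep_graph: "set_pmf (indep_graph n W) \<subseteq> Pow (edges_on n)"
  using bij_betw_vertex_pairs[of n] by (auto simp: indep_graph_def bij_betw_def)

lemma graphs_with_degrees_subset: "graphs_with_degrees n d \<subseteq> Pow (edges_on n)"
  by (auto simp: graphs_with_degrees_def simple_graph_def edges_on_def)

lemma card_graphs_with_degrees:
  assumes "G \<in> graphs_with_degrees n d"
  shows "norm1 n d = 2 * card G"
proof -
  have "norm1 n d = (\<Sum>v\<in>{1..n}. degree G v)"
    using assms by (simp add: norm1_def graphs_with_degrees_def)
  also have "\<dots> = 2 * card G" using assms by (intro handshake) (simp add: graphs_with_degrees_def)
  finally show ?thesis .
qed

lemma degree_le:
  assumes "simple_graph n G"
  shows "degree G v \<le> n"
proof -
  have "neighbours G v \<subseteq> {1..n}" using assms by (auto simp: neighbours_def dest: simple_graph_edgeD)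
  then have "card (neighbours G v) \<le> card {1..n}" by (intro card_mono) auto
  then show ?thesis by (simp add: card_neighbours[OF assms])
qed

lemma prob_matrix_sym: "prob_matrix n d i j = prob_matrix n d j i"
  by (simp add: prob_matrix_def mult.commute)

lemma prob_matrix_bounds: "0 \<le> prob_matrix n d i j" "prob_matrix n d i j \<le> 1"
proof -
  have "a / (b + a) \<le> 1" if "0 \<le> a" "0 \<le> b" for a b :: real
    using that by (cases "b + a = 0") (auto simp: divide_le_eq_1)
  then show "prob_matrix n d i j \<le> 1" by (simp add: prob_matrix_def)
qed (simp add: prob_matrix_def)

text \<open>\<open>Min\<close> and \<open>Max\<close> merely pick an order of the ends; by symmetry
  of the matrix either order gives the same value.\<close>

definition edge_prob :: "nat \<Rightarrow> (nat \<Rightarrow> nat) \<Rightarrow> nat set \<Rightarrow> real" where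
  "edge_prob n d e = prob_matrix n d (Min e) (Max e)"

lemma edge_prob_doubleton: "edge_prob n d {j, k} = prob_matrix n d j k"
  by (cases "j \<le> k") (auto simp: edge_prob_def min_def max_def prob_matrix_sym)

text \<open>Drop the product from the denominator and expand the square of the degree sum, in which
  each pair occurs twice. The bound equals the number of edges, so the intended draw probabilities
  sum to at most one.\<close>

lemma sum_edge_prob_le:
  assumes "norm1 n d > 0"
  shows "sum (edge_prob n d) (edges_on n) \<le> real (norm1 n d) / 2"
proof -
  let ?V = "vertex_pairs n" and ?f = "\<lambda>x. real (d (fst x)) * real (d (snd x))"
  have "(\<Sum>x\<in>?V. ?f x) + (\<Sum>x\<in>prod.swap ` ?V. ?f x) = (\<Sum>x\<in>?V \<union> prod.swap ` ?V. ?f x)"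
  proof (rule sum.union_disjoint[symmetric])
    show "?V \<inter> prod.swap ` ?V = {}" by (auto simp: vertex_pairs_def)
  qed (simp_all add: finite_vertex_pairs)
  also have "\<dots> \<le> (\<Sum>x\<in>{1..n} \<times> {1..n}. ?f x)"
    by (rule sum_mono2) (auto simp: vertex_pairs_def)
  also have "\<dots> = (\<Sum>i\<in>{1..n}. real (d i)) * (\<Sum>i\<in>{1..n}. real (d i))"
    unfolding sum_product by (subst sum.cartesian_product) (simp add: case_prod_beta)
  also have "\<dots> = (real (norm1 n d))\<^sup>2" by (simp add: norm1_def power2_eq_square)
  also have "(\<Sum>x\<in>prod.swap ` ?V. ?f x) = (\<Sum>x\<in>?V. ?f x)"
    by (subst sum.reindex) (auto simp: mult.commute)
  finally have le: "2 * (\<Sum>x\<in>?V. ?f x) \<le> (real (norm1 n d))\<^sup>2" by simp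
  have "sum (edge_prob n d) (edges_on n) = (\<Sum>x\<in>?V. edge_prob n d ((\<lambda>(j, k). {j, k}) x))"
    by (rule sum.reindex_bij_betw[OF bij_betw_vertex_pairs, symmetric])
  also have "\<dots> \<le> (\<Sum>x\<in>?V. ?f x / real (norm1 n d))"
    using assms by (intro sum_mono) (auto simp: edge_prob_doubleton prob_matrix_def intro!: divide_left_mono add_pos_nonneg mult_pos_pos)
  also have "\<dots> = (\<Sum>x\<in>?V. ?f x) / real (norm1 n d)" by (simp add: sum_divide_distrib)
  also have "\<dots> \<le> (real (norm1 n d))\<^sup>2 / 2 / real (norm1 n d)"
    using le assms by (intro divide_right_mono) auto
  finally show ?thesis using assms by (simp add: power2_eq_square)
qed

text \<open>Turns a switching ratio into a probability. With x = d_i d_j / N the quotient x / (1 +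
  x) is the matrix entry, which explains the denominator of \<open>prob_matrix\<close>.\<close>

lemma proportion_ge:
  fixes A B c x :: real
  assumes "0 \<le> A" "0 \<le> B" "0 < A + B" "B * (c * x) \<le> A" "0 \<le> c" "c \<le> 1" "0 \<le> x"
  shows "c * (x / (1 + x)) \<le> A / (A + B)"
proof -
  have "c * x * (A + B) \<le> A * (1 + c * x)" using assms by (simp add: algebra_simps)
  then have "c * x / (1 + c * x) \<le> A / (A + B)"
    using assms by (simp add: field_simps add_pos_nonneg)
  moreover have "c * x / (1 + x) \<le> c * x / (1 + c * x)"
    using assms by (intro divide_left_mono mult_pos_pos add_pos_nonneg) (auto simp: mult_left_le_one_le)
  ultimately show ?thesis by simp
qed

text \<open>One-sided, because the switching wants residual degrees bounded from below; strict, so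
  that the negation is a tail event of Hoeffding's form.\<close>

definition evenly_revealed :: "nat \<Rightarrow> (nat \<Rightarrow> nat) \<Rightarrow> nat \<Rightarrow> real \<Rightarrow> graph \<Rightarrow> bool" where
  "evenly_revealed n d m \<eta> H \<longleftrightarrow> (\<forall>v\<in>{1..n}. real (degree H v) < (real (card H) / real m + \<eta>) * real (d v))"

text \<open>Each of the three quantities in the switching is at least (1 - \<epsilon>) s times its
  full value, while the square on the other side contributes only s^2. The remaining s cancels when
  dividing by m - k.\<close>

lemma edge_prob_le_next_elem:
  assumes \<epsilon>: "0 < \<epsilon>" "\<epsilon> < 1"
    and m: "norm1 n d = 2 * m"
    and J: "4 * real (J n d) \<le> \<epsilon>\<^sup>2 * real (norm1 n d)"
    and H: "real (card H) \<le> (1 - \<epsilon>) * real m" "card H < m" "extensions (graphs_with_degrees n d) H \<noteq> {}"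
    and good: "evenly_revealed n d m (\<epsilon>\<^sup>2) H" and e: "e \<in> edges_on n - H"
  shows "(1 - \<epsilon>) ^ 3 * edge_prob n d e / real m \<le> pmf (next_elem (graphs_with_degrees n d) H) e"
proof -
  define \<Omega> where "\<Omega> = graphs_with_degrees n d"
  define k where "k = card H"
  define s where "s = 1 - real k / real m"
  have m0: "real m > 0" using H(2) by simp
  have card: "card G = m" if "G \<in> \<Omega>" for G
    using card_graphs_with_degrees[of G n d] that m by (simp add: \<Omega>_def)
  have s: "\<epsilon> \<le> s" "s \<le> 1" using H(1) m0 by (auto simp: s_def k_def field_simps)
  have s0: "s > 0" using s \<epsilon> by simp
  have ms: "real (m - k) = real m * s" using H(2) m0 by (simp add: s_def k_def field_simps of_nat_diff)
  obtain i j where ij: "e = {i, j}" "i \<noteq> j" "i \<in> {1..n}" "j \<in> {1..n}"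
    using e by (auto simp: edges_on_def card_2_iff)
  obtain G0 where G0: "G0 \<in> \<Omega>" "H \<subseteq> G0" using H(3) by (auto simp: extensions_def \<Omega>_def)
  have residual: "(1 - \<epsilon>) * s * real (d v) \<le> real (d v - degree H v)" if v: "v \<in> {1..n}" for v
  proof -
    have "finite G0" "degree G0 v = d v"
      using G0(1) v by (auto simp: \<Omega>_def graphs_with_degrees_def intro: simple_graph_finite)
    then have "degree H v \<le> d v" using degree_mono[OF _ G0(2)] by metis
    moreover have "real (degree H v) \<le> (1 - s + \<epsilon>\<^sup>2) * real (d v)"
      using good v by (auto simp: evenly_revealed_def s_def k_def intro: less_imp_le)
    \<comment> \<open>The tolerance was chosen as \<open>\<epsilon>\<^sup>2\<close> for this: s
      never drops below \<epsilon>, so the error is relative.\<close>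
    moreover have "\<epsilon>\<^sup>2 \<le> \<epsilon> * s" using s \<epsilon> by (simp add: power2_eq_square)
    then have "\<epsilon>\<^sup>2 * real (d v) \<le> \<epsilon> * s * real (d v)" by (intro mult_right_mono) auto
    ultimately show ?thesis by (simp add: of_nat_diff algebra_simps)
  qed
  define A where "A = extensions \<Omega> (insert e H)"
  define B where "B = {G \<in> extensions \<Omega> H. e \<notin> G}"
  have finO: "finite \<Omega>"
    unfolding \<Omega>_def using graphs_with_degrees_subset finite_edges_on by (metis finite_Pow_iff finite_subset)
  have AB: "card (extensions \<Omega> H) = card A + card B"
  proof -
    have "extensions \<Omega> H = A \<union> B" "A \<inter> B = {}" by (auto simp: A_def B_def extensions_def)
    moreover have "finite A" "finite B" using finO by (auto simp: A_def B_def extensions_def)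
    ultimately show ?thesis by (simp only: card_Un_disjoint)
  qed
  define N where "N = real (norm1 n d)"
  have N: "N = 2 * real m" by (simp add: N_def m)
  have N0: "N > 0" using m0 by (simp add: N)
  define M where "M = 2 * (m - k)"
  have M: "real M = s * N" by (simp add: M_def ms N)
  have "card B * ((d i - degree H i) * (d j - degree H j) * (M - 4 * J n d)) \<le> card A * M\<^sup>2"
    unfolding A_def B_def \<Omega>_def ij(1) k_def M_def
    using ij e card by (intro switching) (auto simp: \<Omega>_def)
  then have "real (card B * ((d i - degree H i) * (d j - degree H j) * (M - 4 * J n d)))
      \<le> real (card A * M\<^sup>2)" by (simp only: of_nat_le_iff)
  then have sw: "real (card B) * (real (d i - degree H i) * real (d j - degree H j) * real (M - 4 * J n d))
      \<le> real (card A) * (s * N)\<^sup>2"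
    by (simp only: of_nat_mult of_nat_power M)
  have "(1 - \<epsilon>) * (s * N) \<le> real (M - 4 * J n d)"
  proof -
    have "\<epsilon>\<^sup>2 * N \<le> \<epsilon> * s * N" using s \<epsilon> N0 by (simp add: power2_eq_square)
    then have "4 * real (J n d) \<le> \<epsilon> * s * N" using J by (simp add: N_def)
    moreover have "real M - 4 * real (J n d) \<le> real (M - 4 * J n d)" by linarith
    ultimately show ?thesis unfolding M by (simp add: algebra_simps)
  qed
  then have "((1 - \<epsilon>) * s * real (d i)) * ((1 - \<epsilon>) * s * real (d j)) * ((1 - \<epsilon>) * (s * N))
      \<le> real (d i - degree H i) * real (d j - degree H j) * real (M - 4 * J n d)"
    using residual[OF ij(3)] residual[OF ij(4)] \<epsilon> s0 N0 by (intro mult_mono) auto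
  then have "real (card B) * (((1 - \<epsilon>) * s * real (d i)) * ((1 - \<epsilon>) * s * real (d j)) * ((1 - \<epsilon>) * (s * N)))
      \<le> real (card A) * (s * N)\<^sup>2"
    using sw by (meson mult_left_mono of_nat_0_le_iff order_trans)
  moreover define x where "x = real (d i) * real (d j) / N"
  have "real (card B) * (((1 - \<epsilon>) * s * real (d i)) * ((1 - \<epsilon>) * s * real (d j)) * ((1 - \<epsilon>) * (s * N)))
      = real (card B) * ((1 - \<epsilon>) ^ 3 * s * x) * (s * N)\<^sup>2"
    using N0 by (simp add: x_def power2_eq_square power3_eq_cube)
  ultimately have "real (card B) * ((1 - \<epsilon>) ^ 3 * s * x) * (s * N)\<^sup>2 \<le> real (card A) * (s * N)\<^sup>2" by simp
  then have Bx: "real (card B) * ((1 - \<epsilon>) ^ 3 * s * x) \<le> real (card A)"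
    using s0 N0 by simp
  have "card (extensions \<Omega> H) > 0"
    using H(3) finO by (auto simp: card_gt_0_iff \<Omega>_def extensions_def)
  then have ABpos: "0 < real (card A) + real (card B)" using AB by linarith
  have c: "(1 - \<epsilon>) ^ 3 \<le> 1" "0 \<le> (1 - \<epsilon>) ^ 3" using \<epsilon> by (auto intro: power_le_one)
  have "(1 - \<epsilon>) ^ 3 * s * (x / (1 + x)) \<le> real (card A) / (real (card A) + real (card B))"
    using Bx ABpos c s s0 N0 by (intro proportion_ge) (auto simp: x_def intro: mult_le_one)
  moreover have "x / (1 + x) = edge_prob n d e"
    using N0 ij by (simp add: x_def edge_prob_doubleton prob_matrix_def N_def field_simps)
  ultimately have le: "(1 - \<epsilon>) ^ 3 * s * edge_prob n d e \<le> real (card A) / real (card (extensions \<Omega> H))"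
    by (simp add: AB)
  have "pmf (next_elem \<Omega> H) e = real (card A) / real (card (extensions \<Omega> H)) / real (m - k)"
  proof -
    have "pmf (next_elem \<Omega> H) e = card A / (card (extensions \<Omega> H) * (m - k))"
      unfolding A_def k_def
      by (rule pmf_next_elem[OF finite_edges_on[of n]]) (use G0 card H e graphs_with_degrees_subset in \<open>auto simp: \<Omega>_def\<close>)
    then show ?thesis by simp
  qed
  also have "\<dots> \<ge> (1 - \<epsilon>) ^ 3 * s * edge_prob n d e / real (m - k)"
    using le by (intro divide_right_mono) auto
  also have "(1 - \<epsilon>) ^ 3 * s * edge_prob n d e / real (m - k) = (1 - \<epsilon>) ^ 3 * edge_prob n d e / real m"
    using s0 m0 by (simp add: ms)
  finally show ?thesis by (simp add: \<Omega>_def)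
qed

lemma prob_not_evenly_revealed_le:
  assumes "graphs_with_degrees n d \<noteq> {}" and m: "norm1 n d = 2 * m" and k: "k < m" and "0 \<le> \<eta>"
  shows "measure_pmf.prob (revealed (graphs_with_degrees n d) k) {H. \<not> evenly_revealed n d m \<eta> H}
    \<le> real n * (real (m + 1) * exp (- 2 * \<eta>\<^sup>2 * real (min_deg n d)))"
proof -
  define \<Omega> where "\<Omega> = graphs_with_degrees n d"
  have card: "card G = m" if "G \<in> \<Omega>" for G
    using card_graphs_with_degrees[of G n d] that m by (simp add: \<Omega>_def)
  have ctx: "finite (edges_on n)" "\<Omega> \<subseteq> Pow (edges_on n)" "\<Omega> \<noteq> {}" "\<And>G. G \<in> \<Omega> \<Longrightarrow> card G = m"
    using finite_edges_on graphs_with_degrees_subset assms card by (auto simp: \<Omega>_def)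
  define bad where "bad v = {H. (real k / real m + \<eta>) * real (d v) \<le> real (card (H \<inter> {e. v \<in> e}))}" for v
  have one: "measure_pmf.prob (revealed \<Omega> k) (bad v) \<le> real (m + 1) * exp (- 2 * \<eta>\<^sup>2 * real (min_deg n d))"
    if v: "v \<in> {1..n}" for v
  proof -
    have "measure_pmf.prob (revealed \<Omega> k) (bad v) \<le> real (m + 1) * exp (- 2 * \<eta>\<^sup>2 * real (d v))"
      unfolding bad_def
    proof (rule prob_revealed_large_intersection_le[OF ctx])
      fix G assume "G \<in> \<Omega>"
      then have "degree G v = d v" using v by (auto simp: \<Omega>_def graphs_with_degrees_def)
      then show "card (G \<inter> {e. v \<in> e}) = d v" by (simp add: degree_def Int_def)
    qed (use assms in auto)
    also have "min_deg n d \<le> d v" using v by (auto simp: min_deg_def)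
    then have "exp (- 2 * \<eta>\<^sup>2 * real (d v)) \<le> exp (- 2 * \<eta>\<^sup>2 * real (min_deg n d))"
      by (simp add: mult_left_mono)
    then have "real (m + 1) * exp (- 2 * \<eta>\<^sup>2 * real (d v)) \<le> real (m + 1) * exp (- 2 * \<eta>\<^sup>2 * real (min_deg n d))"
      by (intro mult_left_mono) auto
    finally show ?thesis .
  qed
  have "measure_pmf.prob (revealed \<Omega> k) {H. \<not> evenly_revealed n d m \<eta> H} \<le> measure_pmf.prob (revealed \<Omega> k) (\<Union>v\<in>{1..n}. bad v)"
  proof (rule measure_pmf.finite_measure_mono_AE)
    show "AE H in measure_pmf (revealed \<Omega> k). H \<in> {H. \<not> evenly_revealed n d m \<eta> H} \<longrightarrow> H \<in> (\<Union>v\<in>{1..n}. bad v)"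
    proof (rule AE_pmfI)
      fix H assume "H \<in> set_pmf (revealed \<Omega> k)"
      then have "card H = k" using set_revealed[OF ctx] k by auto
      then show "H \<in> {H. \<not> evenly_revealed n d m \<eta> H} \<longrightarrow> H \<in> (\<Union>v\<in>{1..n}. bad v)"
        by (auto simp: evenly_revealed_def bad_def degree_def Int_def not_less)
    qed
  qed simp
  also have "\<dots> \<le> (\<Sum>v\<in>{1..n}. measure_pmf.prob (revealed \<Omega> k) (bad v))"
    by (rule measure_pmf.finite_measure_subadditive_finite) auto
  also have "\<dots> \<le> (\<Sum>v\<in>{1..n}. real (m + 1) * exp (- 2 * \<eta>\<^sup>2 * real (min_deg n d)))"
    by (intro sum_mono one)
  finally show ?thesis by (simp add: \<Omega>_def)
qed

lemma ex_coupling_indep_uniform: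
  assumes \<epsilon>: "0 < \<epsilon>" "\<epsilon> < 1"
    and deg: "degree_sequence n d"
    and m: "norm1 n d = 2 * m" "m > 0"
    and J: "4 * real (J n d) \<le> \<epsilon>\<^sup>2 * real (norm1 n d)"
  defines "W \<equiv> \<lambda>i j. 1 - exp (- ((1 - \<epsilon>) ^ 5 * prob_matrix n d i j))"
  shows "\<exists>\<mu>. coupling \<mu> (indep_graph n W) (uniform_graph n d) \<and>
    measure_pmf.prob \<mu> {(F, G). \<not> F \<subseteq> G} \<le> exp ((1 - \<epsilon>) * (\<epsilon> + ln (1 - \<epsilon>)) * real m) +
      real m * (real n * (real (m + 1) * exp (- 2 * \<epsilon> ^ 4 * real (min_deg n d))))"
proof -
  define \<Omega> where "\<Omega> = graphs_with_degrees n d"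
  define K where "K = nat \<lfloor>(1 - \<epsilon>) * real m\<rfloor>"
  define q where "q e = (1 - \<epsilon>) ^ 3 * edge_prob n d e / real m" for e
  \<comment> \<open>A factor 1 - \<epsilon> below the time horizon, so that exceeding
    \<open>K\<close> is a large deviation; together with \<open>q\<close> it gives the intensity (1
    - \<epsilon>)^5 P on each edge.\<close>
  define r where "r = (1 - \<epsilon>)\<^sup>2 * real m"
  have card: "card G = m" if "G \<in> \<Omega>" for G
    using card_graphs_with_degrees[of G n d] that m by (simp add: \<Omega>_def)
  have ctx: "finite (edges_on n)" "\<Omega> \<subseteq> Pow (edges_on n)" "\<Omega> \<noteq> {}" "\<And>G. G \<in> \<Omega> \<Longrightarrow> card G = m"
    using finite_edges_on graphs_with_degrees_subset deg card by (auto simp: \<Omega>_def degree_sequence_def)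
  have c: "(1 - \<epsilon>) ^ 3 \<le> 1" "0 \<le> (1 - \<epsilon>) ^ 3" using \<epsilon> by (auto intro: power_le_one)
  have ep0: "0 \<le> edge_prob n d e" for e by (simp add: edge_prob_def prob_matrix_bounds)
  have q0: "0 \<le> q e" for e using c ep0 by (simp add: q_def)
  have r0: "r > 0" using \<epsilon> m by (simp add: r_def)
  have Kreal: "real K \<le> (1 - \<epsilon>) * real m" "(1 - \<epsilon>) * real m < real K + 1"
    using \<epsilon> by (auto simp: K_def)
  have "(1 - \<epsilon>) * real m < 1 * real m" using \<epsilon> m by (intro mult_strict_right_mono) auto
  then have Km: "K < m" using Kreal by linarith
  have "sum q (edges_on n) = (1 - \<epsilon>) ^ 3 * (sum (edge_prob n d) (edges_on n) / real m)"
    by (simp add: q_def sum_distrib_left sum_divide_distrib)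
  also have "\<dots> \<le> 1 * 1"
  proof (intro mult_mono c)
    have "sum (edge_prob n d) (edges_on n) \<le> real m" using sum_edge_prob_le[of n d] m by simp
    then show "sum (edge_prob n d) (edges_on n) / real m \<le> 1" using m by simp
  qed (use ep0 in \<open>auto intro!: divide_nonneg_nonneg sum_nonneg\<close>)
  finally have "sum q (edges_on n) \<le> 1" by simp
  then obtain p where p: "set_pmf p \<subseteq> insert None (Some ` edges_on n)"
      "\<And>e. e \<in> edges_on n \<Longrightarrow> pmf p (Some e) = q e"
    using ex_option_pmf[OF finite_edges_on, of n q] q0 by blast
  have "\<exists>\<mu>. coupling \<mu> (bind_pmf (poisson_pmf r) (draws p)) (pmf_of_set \<Omega>) \<and>
    measure_pmf.prob \<mu> {(F, G). \<not> F \<subseteq> G} \<le> measure_pmf.prob (poisson_pmf r) {k. K < k} +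
      (\<Sum>i<K. measure_pmf.prob (revealed \<Omega> i) {H. \<not> evenly_revealed n d m (\<epsilon>\<^sup>2) H})"
  proof (rule ex_coupling_poisson_draws[OF ctx p(1)])
    fix H e assume H: "card H < K" "extensions \<Omega> H \<noteq> {}" "evenly_revealed n d m (\<epsilon>\<^sup>2) H" and e: "e \<in> edges_on n - H"
    have "(1 - \<epsilon>) ^ 3 * edge_prob n d e / real m \<le> pmf (next_elem (graphs_with_degrees n d) H) e"
      using H Kreal(1) Km e by (intro edge_prob_le_next_elem[OF \<epsilon> m(1) J]) (auto simp: \<Omega>_def)
    then show "pmf p (Some e) \<le> pmf (next_elem \<Omega> H) e"
      using p(2)[of e] e by (simp add: q_def \<Omega>_def)
  qed (use Km in auto)
  then obtain \<mu> where \<mu>: "coupling \<mu> (bind_pmf (poisson_pmf r) (draws p)) (pmf_of_set \<Omega>)"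
    and le: "measure_pmf.prob \<mu> {(F, G). \<not> F \<subseteq> G} \<le> measure_pmf.prob (poisson_pmf r) {k. K < k} +
      (\<Sum>i<K. measure_pmf.prob (revealed \<Omega> i) {H. \<not> evenly_revealed n d m (\<epsilon>\<^sup>2) H})" by blast
  have "bind_pmf (poisson_pmf r) (draws p) = indep_graph n W"
  \<comment> \<open>Laws of random sets are determined by the chances of staying inside each
    \<open>S\<close>, and both sides have these in closed form.\<close>
  proof (rule pmf_eqI_Pow[OF finite_edges_on[of n]])
    show "set_pmf (bind_pmf (poisson_pmf r) (draws p)) \<subseteq> Pow (edges_on n)"
      using set_draws[OF p(1)] by auto
    show "set_pmf (indep_graph n W) \<subseteq> Pow (edges_on n)" by (rule set_indep_graph)
    fix S assume S: "S \<subseteq> edges_on n"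
    define w where "w e = (1 - \<epsilon>) ^ 5 * edge_prob n d e" for e
    have "measure_pmf.prob (indep_graph n W) (Pow S) = exp (- sum w (edges_on n - S))"
      using \<epsilon> ep0 by (intro prob_indep_graph_Pow) (auto simp: W_def w_def edge_prob_doubleton)
    also have "sum w (edges_on n - S) = r * sum q (edges_on n - S)"
    proof -
      have "(1 - \<epsilon>) ^ 5 = (1 - \<epsilon>)\<^sup>2 * (1 - \<epsilon>) ^ 3" by (simp flip: power_add)
      then have "w = (\<lambda>e. r * q e)" using m by (simp add: fun_eq_iff w_def q_def r_def)
      then show ?thesis by (simp only: sum_distrib_left)
    qed
    finally show "measure_pmf.prob (bind_pmf (poisson_pmf r) (draws p)) (Pow S) = measure_pmf.prob (indep_graph n W) (Pow S)"
      using poisson_draws_Pow[OF finite_edges_on p r0 S] by simp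
  qed
  with \<mu> have "coupling \<mu> (indep_graph n W) (uniform_graph n d)"
    by (simp add: uniform_graph_def \<Omega>_def)
  moreover have "measure_pmf.prob (poisson_pmf r) {k. K < k} \<le> exp ((1 - \<epsilon>) * (\<epsilon> + ln (1 - \<epsilon>)) * real m)"
  proof -
    \<comment> \<open>Exceeding the floor means reaching \<open>K + 1\<close>, which is beyond (1 -
      \<epsilon>) m. The choice z = 1 / (1 - \<epsilon>) below, threshold over mean, optimises the
      Chernoff bound.\<close>
    have "measure_pmf.prob (poisson_pmf r) {k. K < k} \<le> measure_pmf.prob (poisson_pmf r) {k. (1 - \<epsilon>) * real m \<le> real k}"
      using Kreal(2) by (intro measure_pmf.finite_measure_mono) auto
    also have "\<dots> \<le> exp (r * (1 / (1 - \<epsilon>) - 1)) / (1 / (1 - \<epsilon>)) powr ((1 - \<epsilon>) * real m)"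
      using \<epsilon> r0 by (intro prob_poisson_ge) auto
    also have "(1 / (1 - \<epsilon>)) powr ((1 - \<epsilon>) * real m) = exp (- ((1 - \<epsilon>) * real m * ln (1 - \<epsilon>)))"
      using \<epsilon> by (simp add: powr_def ln_div)
    also have "r * (1 / (1 - \<epsilon>) - 1) = (1 - \<epsilon>) * real m * \<epsilon>"
      using \<epsilon> by (simp add: r_def power2_eq_square field_simps)
    also have "exp ((1 - \<epsilon>) * real m * \<epsilon>) / exp (- ((1 - \<epsilon>) * real m * ln (1 - \<epsilon>)))
      = exp ((1 - \<epsilon>) * (\<epsilon> + ln (1 - \<epsilon>)) * real m)"
      by (simp add: exp_diff[symmetric] algebra_simps)
    finally show ?thesis .
  qed
  moreover have "(\<Sum>i<K. measure_pmf.prob (revealed \<Omega> i) {H. \<not> evenly_revealed n d m (\<epsilon>\<^sup>2) H})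
    \<le> real m * (real n * (real (m + 1) * exp (- 2 * \<epsilon> ^ 4 * real (min_deg n d))))"
  proof -
    have "measure_pmf.prob (revealed \<Omega> i) {H. \<not> evenly_revealed n d m (\<epsilon>\<^sup>2) H}
        \<le> real n * (real (m + 1) * exp (- 2 * \<epsilon> ^ 4 * real (min_deg n d)))" if "i < K" for i
      using prob_not_evenly_revealed_le[of n d m i "\<epsilon>\<^sup>2"] that Km m(1) ctx(3) by (simp add: \<Omega>_def flip: power_mult)
    then have "(\<Sum>i<K. measure_pmf.prob (revealed \<Omega> i) {H. \<not> evenly_revealed n d m (\<epsilon>\<^sup>2) H})
        \<le> (\<Sum>i<K. real n * (real (m + 1) * exp (- 2 * \<epsilon> ^ 4 * real (min_deg n d))))"
      by (intro sum_mono) auto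
    also have "\<dots> = real K * (real n * (real (m + 1) * exp (- 2 * \<epsilon> ^ 4 * real (min_deg n d))))" by simp
    also have "\<dots> \<le> real m * (real n * (real (m + 1) * exp (- 2 * \<epsilon> ^ 4 * real (min_deg n d))))"
      using Km by (intro mult_right_mono) auto
    finally show ?thesis .
  qed
  ultimately show ?thesis using le by (intro exI[of _ \<mu>]) auto
qed

section \<open>Asymptotics\<close>

text \<open>Diagonal choice: at \<open>n\<close> take the finest tolerance 1 / (k + 1) with
  \<open>k \<le> n\<close> that already works. The cap makes the maximum exist, and the hypothesis
  at 1 provides \<open>k = 0\<close>.\<close>

lemma ex_null_sequence_of_eventually:
  fixes Q :: "real \<Rightarrow> nat \<Rightarrow> bool"
  assumes ev: "\<And>\<eta>. 0 < \<eta> \<Longrightarrow> \<forall>\<^sub>F n in sequentially. Q \<eta> n" and one: "\<And>n. Q 1 n"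
  shows "\<exists>\<eta>. \<eta> \<longlonglongrightarrow> 0 \<and> (\<forall>n. 0 < \<eta> n \<and> Q (\<eta> n) n)"
proof -
  define S where "S n = {k. k \<le> n \<and> Q (1 / real (Suc k)) n}" for n
  define N where "N n = Max (S n)" for n
  define \<eta> where "\<eta> n = 1 / real (Suc (N n))" for n
  have fin: "finite (S n)" for n by (simp add: S_def)
  have "0 \<in> S n" for n using one by (simp add: S_def)
  then have "N n \<in> S n" for n unfolding N_def using fin Max_in by blast
  then have Q: "Q (\<eta> n) n" for n by (simp add: S_def \<eta>_def)
  have "\<eta> \<longlonglongrightarrow> 0"
  proof (rule tendstoI)
    fix e :: real assume "e > 0"
    then obtain k where k: "1 / real (Suc k) < e" by (metis nat_approx_posE)
    have "\<forall>\<^sub>F n in sequentially. k \<le> n \<and> Q (1 / real (Suc k)) n"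
      by (intro eventually_conj ev eventually_ge_at_top) simp
    then show "\<forall>\<^sub>F n in sequentially. dist (\<eta> n) 0 < e"
    proof eventually_elim
      case (elim n)
      then have "k \<le> N n" unfolding N_def using fin by (intro Max_ge) (auto simp: S_def)
      then have "\<eta> n \<le> 1 / real (Suc k)" by (simp add: \<eta>_def field_simps)
      moreover have "\<eta> n > 0" by (simp add: \<eta>_def)
      ultimately show ?case using k by simp
    qed
  qed
  moreover have "\<forall>n. 0 < \<eta> n" by (simp add: \<eta>_def)
  ultimately show ?thesis using Q by (intro exI[of _ \<eta>]) simp
qed

text \<open>A single tolerance governs both the entrywise error and the failure probability, so one
  diagonal choice serves for both.\<close>

definition embeds :: "nat \<Rightarrow> (nat \<Rightarrow> nat) \<Rightarrow> real \<Rightarrow> (nat \<Rightarrow> nat \<Rightarrow> real) \<Rightarrow> (nat \<Rightarrow> nat \<Rightarrow> real) \<Rightarrow>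
    (graph \<times> graph) pmf \<Rightarrow> bool" where
  "embeds n d \<eta> W E \<mu> \<longleftrightarrow> symmetric_01 n W \<and>
    (\<forall>i\<in>{1..n}. \<forall>j\<in>{1..n}. W i j = (1 + E i j) * entrywise (\<lambda>x. 1 - exp (- x)) (prob_matrix n d) i j \<and> \<bar>E i j\<bar> \<le> \<eta>) \<and>
    coupling \<mu> (indep_graph n W) (uniform_graph n d) \<and>
    1 - \<eta> \<le> measure_pmf.prob \<mu> {(F, G). F \<subseteq> G}"

text \<open>By concavity of \<open>1 - exp (- x)\<close>, shrinking the argument by \<open>c\<close>
  shrinks the value by a factor between \<open>c\<close> and 1, uniformly in \<open>x\<close>. At
  \<open>x = 0\<close>, as on the diagonal, the quotient is undefined and \<open>t = 0\<close>
  serves.\<close>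

lemma one_minus_exp_scaled:
  fixes c x :: real
  assumes "0 \<le> c" "c \<le> 1" "0 \<le> x"
  obtains t where "1 - exp (- (c * x)) = (1 + t) * (1 - exp (- x))" "\<bar>t\<bar> \<le> 1 - c"
proof (cases "x = 0")
  case True
  with that[of 0] assms show ?thesis by simp
next
  case False
  define t where "t = (1 - exp (- (c * x))) / (1 - exp (- x)) - 1"
  have pos: "1 - exp (- x) > 0" using False assms by simp
  have "exp ((1 - c) *\<^sub>R 0 + c *\<^sub>R (- x)) \<le> (1 - c) * exp 0 + c * exp (- x)"
    by (rule convex_onD[OF convex_on_exp[of 1, simplified]]) (use assms in auto)
  then have "c * (1 - exp (- x)) \<le> 1 - exp (- (c * x))" by (simp add: algebra_simps)
  then have "c \<le> (1 - exp (- (c * x))) / (1 - exp (- x))" using pos by (simp add: field_simps)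
  moreover have "1 - exp (- (c * x)) \<le> 1 - exp (- x)"
    using assms by (simp add: mult_left_le_one_le)
  then have "(1 - exp (- (c * x))) / (1 - exp (- x)) \<le> 1" using pos by simp
  ultimately have "\<bar>t\<bar> \<le> 1 - c" by (simp add: t_def)
  moreover have "1 - exp (- (c * x)) = (1 + t) * (1 - exp (- x))" using pos by (simp add: t_def)
  ultimately show ?thesis using that by blast
qed

text \<open>Tolerance 1 asks nothing of the inclusion, so the independent pair will do. This serves
  the small \<open>n\<close>, at which the theorem still demands exact marginals.\<close>

lemma embeds_trivial: "\<exists>W E \<mu>. embeds n d 1 W E \<mu>"
proof -
  define W where "W = entrywise (\<lambda>x. 1 - exp (- x)) (prob_matrix n d)"
  have "symmetric_01 n W"
    by (auto simp: symmetric_01_def W_def entrywise_def prob_matrix_bounds intro: prob_matrix_sym)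
  then have "embeds n d 1 W (\<lambda>_ _. 0) (pair_pmf (indep_graph n W) (uniform_graph n d))"
    by (simp add: embeds_def coupling_def map_fst_pair_pmf map_snd_pair_pmf W_def)
  then show ?thesis by blast
qed

text \<open>The 5 is Bernoulli's inequality for (1 - \<epsilon>)^5. The fifth power of
  \<open>n\<close> collects up to m times, n vertices and the factor m + 1, with m and m + 1 at most
  n^2.\<close>

lemma ex_embeds:
  assumes \<epsilon>: "0 < \<epsilon>" "\<epsilon> < 1"
    and deg: "degree_sequence n d"
    and pos: "norm1 n d > 0"
    and J: "4 * real (J n d) \<le> \<epsilon>\<^sup>2 * real (norm1 n d)"
    and le: "exp ((1 - \<epsilon>) * (\<epsilon> + ln (1 - \<epsilon>)) * (real (norm1 n d) / 2)) +
      real n ^ 5 * exp (- 2 * \<epsilon> ^ 4 * real (min_deg n d)) \<le> \<epsilon>"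
  shows "\<exists>W E \<mu>. embeds n d (5 * \<epsilon>) W E \<mu>"
proof -
  define c where "c = (1 - \<epsilon>) ^ 5"
  define W where "W = (\<lambda>i j. 1 - exp (- (c * prob_matrix n d i j)))"
  have c: "0 \<le> c" "c \<le> 1" using \<epsilon> by (auto simp: c_def intro: power_le_one)
  have "1 + real 5 * (- \<epsilon>) \<le> (1 + (- \<epsilon>)) ^ 5" by (rule Bernoulli_inequality) (use \<epsilon> in simp)
  then have c5: "1 - c \<le> 5 * \<epsilon>" by (simp add: c_def)
  obtain G where G: "G \<in> graphs_with_degrees n d" using deg by (auto simp: degree_sequence_def)
  define m where "m = card G"
  have m: "norm1 n d = 2 * m" using card_graphs_with_degrees[OF G] by (simp add: m_def)
  then have half: "real (norm1 n d) / 2 = real m" by simp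
  then have half: "real (norm1 n d) / 2 = real m" by simp
  then have half: "real (norm1 n d) / 2 = real m" by simp
  have "norm1 n d \<le> n * n"
  proof -
    have "norm1 n d = (\<Sum>v\<in>{1..n}. degree G v)"
      using G by (simp add: norm1_def graphs_with_degrees_def)
    also have "\<dots> \<le> (\<Sum>v\<in>{1..n}. n)"
      using G by (intro sum_mono degree_le) (auto simp: graphs_with_degrees_def)
    finally show ?thesis by simp
  qed
  then have "m \<le> n * n" "m + 1 \<le> n * n" using m pos by auto
  then have "m * (n * (m + 1)) \<le> (n * n) * (n * (n * n))" by (intro mult_mono) auto
  also have "\<dots> = n ^ 5" by (simp add: eval_nat_numeral)
  finally have "real (m * (n * (m + 1))) \<le> real (n ^ 5)" by (simp only: of_nat_le_iff)
  then have poly: "real m * (real n * real (m + 1)) \<le> real n ^ 5"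
    by (simp only: of_nat_mult of_nat_power)
  obtain \<mu> where \<mu>: "coupling \<mu> (indep_graph n W) (uniform_graph n d)"
    and fail: "measure_pmf.prob \<mu> {(F, G). \<not> F \<subseteq> G} \<le> exp ((1 - \<epsilon>) * (\<epsilon> + ln (1 - \<epsilon>)) * real m) +
      real m * (real n * (real (m + 1) * exp (- 2 * \<epsilon> ^ 4 * real (min_deg n d))))"
    using ex_coupling_indep_uniform[OF \<epsilon> deg m _ J] pos m unfolding W_def c_def by auto
  have "real m * (real n * (real (m + 1) * exp (- 2 * \<epsilon> ^ 4 * real (min_deg n d))))
      = (real m * (real n * real (m + 1))) * exp (- 2 * \<epsilon> ^ 4 * real (min_deg n d))" by simp
  also have "\<dots> \<le> real n ^ 5 * exp (- 2 * \<epsilon> ^ 4 * real (min_deg n d))"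
    using poly by (intro mult_right_mono) auto
  finally have "measure_pmf.prob \<mu> {(F, G). \<not> F \<subseteq> G} \<le> \<epsilon>"
    using fail le unfolding half by linarith
  moreover have "measure_pmf.prob \<mu> {(F, G). F \<subseteq> G} = 1 - measure_pmf.prob \<mu> {(F, G). \<not> F \<subseteq> G}"
  proof -
    have "{(F, G). F \<subseteq> G} = UNIV - {(F :: graph, G). \<not> F \<subseteq> G}" by auto
    moreover have "measure_pmf.prob \<mu> (UNIV - {(F, G). \<not> F \<subseteq> G}) = 1 - measure_pmf.prob \<mu> {(F, G). \<not> F \<subseteq> G}"
      using measure_pmf.prob_compl[of "{(F, G). \<not> F \<subseteq> G}" \<mu>] by simp
    ultimately show ?thesis by (simp only:)
  qed
  ultimately have prob: "1 - 5 * \<epsilon> \<le> measure_pmf.prob \<mu> {(F, G). F \<subseteq> G}" using \<epsilon> by simp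
  have "\<exists>t. W i j = (1 + t) * entrywise (\<lambda>x. 1 - exp (- x)) (prob_matrix n d) i j \<and> \<bar>t\<bar> \<le> 5 * \<epsilon>" for i j
    using one_minus_exp_scaled[OF c prob_matrix_bounds(1)[of n d i j]] c5
    unfolding W_def entrywise_def by (metis order_trans)
  then obtain E where "\<And>i j. W i j = (1 + E i j) * entrywise (\<lambda>x. 1 - exp (- x)) (prob_matrix n d) i j \<and> \<bar>E i j\<bar> \<le> 5 * \<epsilon>"
    by metis
  moreover have "symmetric_01 n W"
    using c by (auto simp: symmetric_01_def W_def prob_matrix_bounds intro: prob_matrix_sym)
  ultimately have "embeds n d (5 * \<epsilon>) W E \<mu>" using \<mu> prob by (simp add: embeds_def)
  then show ?thesis by blast
qed

lemma eventually_ex_embeds: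
  fixes d :: "nat \<Rightarrow> nat \<Rightarrow> nat"
  assumes deg: "\<And>n. degree_sequence n (d n)"
    and J: "(\<lambda>n. real (J n (d n))) \<in> o(\<lambda>n. real (norm1 n (d n)))"
    and min: "(\<lambda>n. real (min_deg n (d n))) \<in> \<omega>(\<lambda>n. ln (real n))"
    and "0 < \<eta>"
  shows "\<forall>\<^sub>F n in sequentially. \<exists>W E \<mu>. embeds n (d n) \<eta> W E \<mu>"
proof -
  define \<epsilon> where "\<epsilon> = min (1 / 2) (\<eta> / 5)"
  have \<epsilon>: "0 < \<epsilon>" "\<epsilon> < 1" "5 * \<epsilon> \<le> \<eta>" using \<open>0 < \<eta>\<close> by (auto simp: \<epsilon>_def)
  define g where "g = (1 - \<epsilon>) * (\<epsilon> + ln (1 - \<epsilon>))"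
  \<comment> \<open>Strictness makes the Poisson tail decay exponentially in the number of edges,
    which is at least n / 2 once all degrees are positive.\<close>
  have "ln (1 + (- \<epsilon>)) < - \<epsilon>"
    using ln_add_one_self_le_self2[of "- \<epsilon>"] ln_eq_minus_one[of "1 - \<epsilon>"] \<epsilon> by fastforce
  then have g: "g < 0" using \<epsilon> by (simp add: g_def mult_pos_neg)
  have "\<forall>\<^sub>F n in sequentially. norm (real (J n (d n))) \<le> (\<epsilon>\<^sup>2 / 4) * norm (real (norm1 n (d n)))"
    using \<epsilon> by (intro landau_o.smallD[OF J]) simp
  moreover have "\<forall>\<^sub>F n in sequentially. norm (real (min_deg n (d n))) \<ge> (3 / \<epsilon> ^ 4 + 1) * norm (ln (real n))"
    \<comment> \<open>The 3 gives an exponent of at least 6 log n, so that n^5 n^(-6) = 1 / n is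
      left; the 1 makes the minimum degree at least one as soon as log n \<ge> 1, which holds from n
      = 3 on.\<close>
    using \<epsilon> by (intro landau_omega.smallD[OF min]) (simp add: add_pos_pos)
  moreover have "\<forall>\<^sub>F n in sequentially. exp (g * (real n / 2)) + 1 / real n \<le> \<epsilon>"
  proof -
    have "((\<lambda>n. exp (g * (real n / 2)) + 1 / real n) \<longlongrightarrow> 0) sequentially"
      using g by real_asymp
    from order_tendstoD(2)[OF this \<epsilon>(1)] show ?thesis by (rule eventually_mono) (rule less_imp_le)
  qed
  ultimately show ?thesis using eventually_ge_at_top[of 3]
  proof eventually_elim
    case (elim n)
    define \<delta> where "\<delta> = min_deg n (d n)"
    have ln1: "1 \<le> ln (real n)"
    proof -
      have "exp 1 \<le> (3 :: real)" by (rule exp_le)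
      also have "3 \<le> real n" using elim(4) by simp
      finally show ?thesis using elim(4) by (subst ln_ge_iff) auto
    qed
    have \<delta>: "(3 / \<epsilon> ^ 4 + 1) * ln (real n) \<le> real \<delta>" using elim(2) ln1 by (simp add: \<delta>_def)
    have "1 * 1 \<le> (3 / \<epsilon> ^ 4 + 1) * ln (real n)" using ln1 \<epsilon> by (intro mult_mono) auto
    then have \<delta>1: "1 \<le> \<delta>" using \<delta> by linarith
    have N: "n \<le> norm1 n (d n)"
    proof -
      have "n = (\<Sum>v\<in>{1..n}. 1)" by simp
      also have "\<dots> \<le> (\<Sum>v\<in>{1..n}. d n v)"
      proof (rule sum_mono)
        fix v assume "v \<in> {1..n}"
        then have "\<delta> \<le> d n v" by (auto simp: \<delta>_def min_deg_def)
        with \<delta>1 show "1 \<le> d n v" by simp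
      qed
      finally show ?thesis by (simp add: norm1_def)
    qed
    have "exp (g * (real (norm1 n (d n)) / 2)) \<le> exp (g * (real n / 2))"
      using N g by (simp add: mult_left_mono_neg)
    moreover have "real n ^ 5 * exp (- 2 * \<epsilon> ^ 4 * real \<delta>) \<le> 1 / real n"
    proof -
      have "6 * ln (real n) \<le> 2 * \<epsilon> ^ 4 * ((3 / \<epsilon> ^ 4 + 1) * ln (real n))"
        using \<epsilon> ln1 by (simp add: field_simps)
      also have "\<dots> \<le> 2 * \<epsilon> ^ 4 * real \<delta>" using \<delta> \<epsilon> by (intro mult_left_mono) auto
      finally have "exp (- 2 * \<epsilon> ^ 4 * real \<delta>) \<le> exp (- (6 * ln (real n)))" by simp
      also have "\<dots> = 1 / real n ^ 6"
      proof -
        have "exp (6 * ln (real n)) = real n ^ 6"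
          using exp_of_nat_mult[of 6 "ln (real n)"] elim(4) by simp
        then show ?thesis by (simp add: exp_minus inverse_eq_divide)
      qed
      finally have "real n ^ 5 * exp (- 2 * \<epsilon> ^ 4 * real \<delta>) \<le> real n ^ 5 * (1 / real n ^ 6)"
        by (intro mult_left_mono) auto
      also have "\<dots> = 1 / real n" using elim(4) by (simp add: field_simps eval_nat_numeral)
      finally show ?thesis .
    qed
    ultimately have "exp (g * (real (norm1 n (d n)) / 2)) + real n ^ 5 * exp (- 2 * \<epsilon> ^ 4 * real (min_deg n (d n))) \<le> \<epsilon>"
      using elim(3) unfolding \<delta>_def by linarith
    moreover have "4 * real (J n (d n)) \<le> \<epsilon>\<^sup>2 * real (norm1 n (d n))" using elim(1) by simp
    ultimately obtain W E \<mu> where "embeds n (d n) (5 * \<epsilon>) W E \<mu>"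
      using ex_embeds[OF \<epsilon>(1,2) deg[of n]] N elim(4) unfolding g_def by fastforce
    then have "embeds n (d n) \<eta> W E \<mu>" using \<epsilon>(3) unfolding embeds_def by fastforce
    then show ?case by blast
  qed
qed

theorem theorem3:
  fixes d :: "nat \<Rightarrow> nat \<Rightarrow> nat"
  assumes "\<And>n. degree_sequence n (d n)"
    and "(\<lambda>n. real (J n (d n))) \<in> o(\<lambda>n. real (norm1 n (d n)))"
    and "(\<lambda>n. real (min_deg n (d n))) \<in> \<omega>(\<lambda>n. ln (real n))"
  shows "\<exists>W E :: nat \<Rightarrow> nat \<Rightarrow> nat \<Rightarrow> real. \<exists>\<mu> :: nat \<Rightarrow> (graph \<times> graph) pmf.
    (\<forall>n. symmetric_01 n (W n)) \<and>
    (\<forall>n. \<forall>i\<in>{1..n}. \<forall>j\<in>{1..n}.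
       W n i j = (1 + E n i j) * entrywise (\<lambda>x. 1 - exp (- x)) (prob_matrix n (d n)) i j) \<and>
    uniformly_o1 E \<and>
    (\<forall>n. coupling (\<mu> n) (indep_graph n (W n)) (uniform_graph n (d n))) \<and>
    (\<lambda>n. measure_pmf.prob (\<mu> n) {(G\<^sub>L, G). G\<^sub>L \<subseteq> G}) \<longlonglongrightarrow> 1"
proof -
  \<comment> \<open>The fixed tolerance is replaced by one that vanishes with \<open>n\<close>; it
    dominates every entry of \<open>E\<close> at once, which is the required uniformity.\<close>
  obtain \<eta> where \<eta>: "\<eta> \<longlonglongrightarrow> 0" "\<And>n. \<exists>W E \<mu>. embeds n (d n) (\<eta> n) W E \<mu>"
    using ex_null_sequence_of_eventually[of "\<lambda>\<eta> n. \<exists>W E \<mu>. embeds n (d n) \<eta> W E \<mu>"]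
      eventually_ex_embeds[OF assms] embeds_trivial by blast
  then obtain W E \<mu> where emb: "\<And>n. embeds n (d n) (\<eta> n) (W n) (E n) (\<mu> n)" by metis
  have "uniformly_o1 E"
    unfolding uniformly_o1_def
  proof (intro allI impI)
    fix e :: real assume "e > 0"
    with \<eta>(1) have "\<forall>\<^sub>F n in sequentially. \<eta> n < e" by (simp add: order_tendstoD)
    then show "\<forall>\<^sub>F n in sequentially. \<forall>i\<in>{1..n}. \<forall>j\<in>{1..n}. \<bar>E n i j\<bar> < e"
    proof eventually_elim
      case (elim n)
      have "\<forall>i\<in>{1..n}. \<forall>j\<in>{1..n}. \<bar>E n i j\<bar> \<le> \<eta> n" using emb[of n] by (simp add: embeds_def)
      then show ?case using elim by (meson le_less_trans)
    qed
  qed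
  moreover have "(\<lambda>n. measure_pmf.prob (\<mu> n) {(F, G). F \<subseteq> G}) \<longlonglongrightarrow> 1"
  proof (rule tendsto_sandwich)
    show "(\<lambda>n. 1 - \<eta> n) \<longlonglongrightarrow> 1" using tendsto_diff[OF tendsto_const \<eta>(1), of 1] by simp
    show "\<forall>\<^sub>F n in sequentially. 1 - \<eta> n \<le> measure_pmf.prob (\<mu> n) {(F, G). F \<subseteq> G}"
      using emb by (simp add: embeds_def)
  qed auto
  ultimately show ?thesis
    using emb by (intro exI[of _ W] exI[of _ E] exI[of _ \<mu>]) (simp add: embeds_def)
qed

end
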